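(* Let $n\ge1$ and let $b\in B_n$ be a braid with closure $\mathrm{cl}(b)$ of writhe $w(\mathrm{cl}(b))$. The element $\lambda^{w(\mathrm{cl}(b))}P(b)$ of the doubled Schur algebra $\dot S_{q,\beta}(n,n)$ acts on the Weyl module $W((\beta)^n,(0)^n)$ as an endomorphism of the highest weight object $1_{((\beta)^n,(0)^n)}$, and this endomorphism is multiplication by the HOMFLY-PT polynomial of the closure of $b$.
   Context: **Doubled Schur algebra.** $\beta$ is a formal parameter, $\lambda=q^\beta$, and the ground ring is $\mathbb Z(q,\lambda)$. For $\ell,k\ge0$ let $\Lambda^\beta_{\ell,k}$ be the set of sequences $(\mu_{-\ell+1},\dots,\mu_0,\dots,\mu_k)\in(\beta-\mathbb N_0)^\ell\times\mathbb N_0^k$, and $I_{\ell,k}=\{-\ell+1,\dots,k-1\}$; $\alpha_i\in\mathbb Z^{\ell+k}$ has $1$ in position $i$, $-1$ in position $i+1$, and $0$ elsewhere. For $x\in\mathbb Z\sqcup(\mathbb Z+\beta)$, $[x]_q=\frac{q^x-q^{-x}}{q-q^{-1}}$ with $q^{\beta}=\lambda$. $\dot S_{q,\beta}(\ell,k)$ is the $\mathbb Z(q,\lambda)$-linear category with objects $1_\mu$, $\mu\in(\beta+\mathbb Z)^\ell\times\mathbb Z^k$, together with a zero object; morphisms are generated by $E_i1_\mu:1_\mu\to1_{\mu+\alpha_i}$, $F_i1_\mu:1_\mu\to1_{\mu-\alpha_i}$ ($i\in I_{\ell,k}$) and the identities $1_\mu$, subject to $(E_iF_j-F_jE_i)1_\mu=\delta_{ij}[\mu_i-\mu_{i+1}]_q1_\mu$;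 for $X=E$ or $F$, $X_iX_j1_\mu=X_jX_i1_\mu$ if $|i-j|>1$ and $X_i^2X_{i\pm1}1_\mu+X_{i\pm1}X_i^21_\mu=(q+q^{-1})X_iX_{i\pm1}X_i1_\mu$; and $1_\mu=0$ whenever $\mu\notin\Lambda_{\ell,k}^\beta$. It is also regarded as an algebra with idempotents $1_\mu$. **Weyl modules.** Define $\nu\preceq\mu$ on $\Lambda^\beta_{\ell,k}$ if $\nu_i-\mu_i\le0$ for all $i\le0$ and $\nu_i-\mu_i\ge0$ for all $i>0$. For $\mu\in\Lambda_{\ell,k}^\beta$ with $\mu_i-\mu_{i+1}\ge0$ for all $i\in I_{\ell,k}\setminus\{0\}$, the Weyl module is $W(\mu)=\dot S_{q,\beta}(\ell,k)1_\mu/(\nu\not\preceq\mu)$, where $(\nu\not\preceq\mu)$ is the left ideal generated by all elements $1_\nu x1_\mu$ with $x\in\dot S_{q,\beta}(\ell,k)$ and $\nu\not\preceq\mu$. The element $1_\mu\in W(\mu)$ is called the highest weight object. **The element $P(b)$** ($\ell=k=n$). Products act from right to left. For $1\le j\le n$ put $C_j=(F_{j-1}F_{-(j-1)})\cdots(F_1F_{-1})F_0$ and $D_j=E_0(E_1E_{-1})\cdots(E_{j-1}E_{-(j-1)})$. The word $C_1C_2\cdots C_n$ ($C_n$ applied first) goes from weight $((\beta)^n,(0)^n)$ to weight $((\beta-1)^n,(1)^n)$, and $D_n\cdots D_1$ goes back; they encode the nested cups and caps closing the braid on its left. On the weight $((\beta-1)^n,(1)^n)$ set, for $1\le i\le n-1$,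 $\sigma_i\mapsto-F_iE_i+q^{-1}$, $\sigma_i^{-1}\mapsto q-E_iF_i$, where $\sigma_i$ is the positive crossing of the $i$th and $(i+1)$th strands from the left (strands upwards, overstrand from bottom left to top right), and let $T(b)$ be the product of these elements for a braid word $b$ (stacking, leftmost on top). Then $P(b)=(D_n\cdots D_1)\,T(b)\,(C_1\cdots C_n)\,1_{((\beta)^n,(0)^n)}$. **HOMFLY-PT polynomial.** The oriented link invariant $\mathrm H$ with values in $\mathbb Z(q,\lambda)$ determined by $\lambda^{-1}\mathrm H(L_+)-\lambda\mathrm H(L_-)=(q^{-1}-q)\mathrm H(L_0)$ and $\mathrm H(\text{unknot})=\frac{\lambda-\lambda^{-1}}{q-q^{-1}}$, where $L_+,L_-,L_0$ differ at one positive crossing, negative crossing, or oriented smoothing. The writhe is the number of positive minus the number of negative crossings. *)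

theory Defs
  imports
    "HOL-Library.Poly_Mapping"
    "HOL-Library.Function_Algebras"
    "HOL-Library.Product_Plus"
    "HOL-Computational_Algebra.Computational_Algebra"
begin

section \<open>The ground ring\<close>

text \<open>\<open>\<int>(q, \<lambda>)\<close> is the field of fractions of \<open>\<int>[q][\<lambda>]\<close>.\<close>

type_synonym ground = "int poly poly fract"

definition qvar :: ground where
  "qvar = Fract [:[:0, 1:]:] 1"

definition lvar :: ground where
  "lvar = Fract [:0, 1:] 1"

text \<open>The pair \<open>(a, m)\<close> stands for \<open>a\<beta> + m\<close>, so \<open>\<int>\<close> and \<open>\<int> + \<beta>\<close> are the pairs with first
  component \<open>0\<close> and \<open>1\<close>.\<close>

type_synonym entry = "int \<times> int"

definition qpow :: "entry \<Rightarrow> ground" where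
  "qpow x = lvar powi fst x * qvar powi snd x"

definition qint :: "entry \<Rightarrow> ground" where
  "qint x = (qpow x - qpow (- x)) / (qvar - inverse qvar)"

section \<open>Weights\<close>

text \<open>A weight \<open>(\<mu>\<^bsub>-\<ell>+1\<^esub>, \<dots>, \<mu>\<^bsub>k\<^esub>)\<close> is a function that is \<open>0\<close> outside \<open>{-\<ell>+1..k}\<close>.
  Weights are added pointwise.\<close>

type_synonym weight = "int \<Rightarrow> entry"

definition objects :: "nat \<Rightarrow> nat \<Rightarrow> weight set" where
  "objects l k = {\<mu>.
     (\<forall>i\<in>{- int l + 1..0}. fst (\<mu> i) = 1) \<and>
     (\<forall>i\<in>{1..int k}. fst (\<mu> i) = 0) \<and>
     (\<forall>i. i \<notin> {- int l + 1..int k} \<longrightarrow> \<mu> i = 0)}"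

definition Lambda :: "nat \<Rightarrow> nat \<Rightarrow> weight set" where
  "Lambda l k = {\<mu> \<in> objects l k.
     (\<forall>i\<in>{- int l + 1..0}. \<exists>a::nat. \<mu> i = (1, - int a)) \<and>
     (\<forall>i\<in>{1..int k}. \<exists>a::nat. \<mu> i = (0, int a))}"

definition Idx :: "nat \<Rightarrow> nat \<Rightarrow> int set" where
  "Idx l k = {- int l + 1..int k - 1}"

definition alpha :: "int \<Rightarrow> weight" where
  "alpha i = (\<lambda>j. if j = i then (0, 1) else if j = i + 1 then (0, - 1) else 0)"

text \<open>On \<open>Lambda l k\<close> the difference of two entries at the same position has no \<open>\<beta>\<close>-part.\<close>

definition weight_le :: "weight \<Rightarrow> weight \<Rightarrow> bool" (infix \<open>\<preceq>\<^sub>w\<close> 50) where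
  "\<nu> \<preceq>\<^sub>w \<mu> \<longleftrightarrow> (\<forall>i\<le>0. snd (\<nu> i - \<mu> i) \<le> 0) \<and> (\<forall>i>0. snd (\<nu> i - \<mu> i) \<ge> 0)"

section \<open>The free algebra on the generators\<close>

datatype gen = GE int | GF int

text \<open>Lists form the free monoid, so \<open>gen list \<Rightarrow>\<^sub>0 ground\<close> with its convolution product is the
  free associative algebra on the symbols \<open>E\<^sub>i\<close>, \<open>F\<^sub>i\<close>. A word acts from right to left.\<close>

instantiation list :: (type) monoid_add
begin

definition zero_list :: "'a list" where "zero_list = []"
definition plus_list :: "'a list \<Rightarrow> 'a list \<Rightarrow> 'a list" where "plus_list = append"

instance
  by standard (simp_all add: zero_list_def plus_list_def)

end

type_synonym free = "gen list \<Rightarrow>\<^sub>0 ground"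

definition E :: "int \<Rightarrow> free" where "E i = Poly_Mapping.single [GE i] 1"
definition F :: "int \<Rightarrow> free" where "F i = Poly_Mapping.single [GF i] 1"
definition scal :: "ground \<Rightarrow> free" where "scal c = Poly_Mapping.single [] c"

fun gen_index :: "gen \<Rightarrow> int" where
  "gen_index (GE i) = i"
| "gen_index (GF i) = i"

fun gen_weight :: "gen \<Rightarrow> weight" where
  "gen_weight (GE i) = alpha i"
| "gen_weight (GF i) = - alpha i"

text \<open>The element \<open>x\<close> of \<open>hom_free l k \<mu> \<nu>\<close> stands for \<open>x 1\<^sub>\<mu>\<close> in the free \<open>\<int>(q, \<lambda>)\<close>-linear
  category: a linear combination of words with letters \<open>E\<^sub>i\<close>, \<open>F\<^sub>i\<close>, \<open>i \<in> Idx l k\<close>, which lead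
  from \<open>\<mu>\<close> to \<open>\<nu>\<close>. Composition is the product of \<^typ>\<open>free\<close>, and \<open>1\<close> is the identity.\<close>

definition hom_free :: "nat \<Rightarrow> nat \<Rightarrow> weight \<Rightarrow> weight \<Rightarrow> free set" where
  "hom_free l k \<mu> \<nu> = {x. \<mu> \<in> objects l k \<and>
     (\<forall>w\<in>Poly_Mapping.keys x. gen_index ` set w \<subseteq> Idx l k \<and>
        \<mu> + sum_list (map gen_weight w) = \<nu>)}"

section \<open>The doubled Schur algebra\<close>

text \<open>The \<open>x\<close> for which the relation \<open>x 1\<^sub>\<mu> = 0\<close> is imposed.\<close>

definition relators :: "nat \<Rightarrow> nat \<Rightarrow> weight \<Rightarrow> free set" where
  "relators l k \<mu> =
     {E i * F j - F j * E i - (if i = j then scal (qint (\<mu> i - \<mu> (i + 1))) else 0) | i j.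
        i \<in> Idx l k \<and> j \<in> Idx l k}
   \<union> {X i * X j - X j * X i | X i j.
        X \<in> {E, F} \<and> i \<in> Idx l k \<and> j \<in> Idx l k \<and> \<bar>i - j\<bar> > 1}
   \<union> {X i ^ 2 * X j + X j * X i ^ 2 - scal (qvar + inverse qvar) * X i * X j * X i | X i j.
        X \<in> {E, F} \<and> i \<in> Idx l k \<and> j \<in> Idx l k \<and> \<bar>i - j\<bar> = 1}
   \<union> (if \<mu> \<in> Lambda l k then {} else {1})"

text \<open>The ideal of the free linear category generated by the relators.\<close>

inductive null :: "nat \<Rightarrow> nat \<Rightarrow> weight \<Rightarrow> weight \<Rightarrow> free \<Rightarrow> bool" for l k where
  zero: "null l k \<mu> \<nu> 0"
| relator: "x \<in> relators l k \<mu> \<Longrightarrow> x \<in> hom_free l k \<mu> \<nu> \<Longrightarrow> null l k \<mu> \<nu> x"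
| add: "null l k \<mu> \<nu> x \<Longrightarrow> null l k \<mu> \<nu> y \<Longrightarrow> null l k \<mu> \<nu> (x + y)"
| post: "null l k \<mu> \<nu> x \<Longrightarrow> y \<in> hom_free l k \<nu> \<rho> \<Longrightarrow> null l k \<mu> \<rho> (y * x)"
| pre: "null l k \<nu> \<rho> x \<Longrightarrow> y \<in> hom_free l k \<mu> \<nu> \<Longrightarrow> null l k \<mu> \<rho> (x * y)"

definition mor :: "nat \<Rightarrow> nat \<Rightarrow> weight \<Rightarrow> weight \<Rightarrow> free \<Rightarrow> free set" where
  "mor l k \<mu> \<nu> x = {y \<in> hom_free l k \<mu> \<nu>. null l k \<mu> \<nu> (y - x)}"

text \<open>\<open>Hom l k \<mu> \<nu> = 1\<^sub>\<nu> S 1\<^sub>\<mu>\<close> is the space of morphisms \<open>1\<^sub>\<mu> \<rightarrow> 1\<^sub>\<nu>\<close> of the doubled Schur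
  algebra \<open>S\<close>. The objects \<open>1\<^sub>\<mu>\<close> with \<open>\<mu> \<notin> Lambda l k\<close> have zero identity, so they are zero objects.\<close>

definition Hom :: "nat \<Rightarrow> nat \<Rightarrow> weight \<Rightarrow> weight \<Rightarrow> free set set" where
  "Hom l k \<mu> \<nu> = mor l k \<mu> \<nu> ` hom_free l k \<mu> \<nu>"

section \<open>Weyl modules\<close>

text \<open>\<open>weyl_null l k \<mu> \<nu>\<close> is the \<open>\<nu>\<close>-weight part of the preimage, in the free category, of the left
  ideal of \<open>S 1\<^sub>\<mu>\<close> generated by all \<open>1\<^sub>\<nu>\<^sub>' x 1\<^sub>\<mu>\<close> with \<open>\<nu>'\<close> not below \<open>\<mu>\<close>.\<close>

inductive weyl_null :: "nat \<Rightarrow> nat \<Rightarrow> weight \<Rightarrow> weight \<Rightarrow> free \<Rightarrow> bool" for l k \<mu> where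
  null: "null l k \<mu> \<nu> x \<Longrightarrow> weyl_null l k \<mu> \<nu> x"
| not_le: "\<nu> \<in> Lambda l k \<Longrightarrow> \<not> \<nu> \<preceq>\<^sub>w \<mu> \<Longrightarrow> x \<in> hom_free l k \<mu> \<nu> \<Longrightarrow> weyl_null l k \<mu> \<nu> x"
| add: "weyl_null l k \<mu> \<nu> x \<Longrightarrow> weyl_null l k \<mu> \<nu> y \<Longrightarrow> weyl_null l k \<mu> \<nu> (x + y)"
| post: "weyl_null l k \<mu> \<nu> x \<Longrightarrow> y \<in> hom_free l k \<nu> \<rho> \<Longrightarrow> weyl_null l k \<mu> \<rho> (y * x)"

definition weyl_elt :: "nat \<Rightarrow> nat \<Rightarrow> weight \<Rightarrow> weight \<Rightarrow> free \<Rightarrow> free set" where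
  "weyl_elt l k \<mu> \<nu> x = {y \<in> hom_free l k \<mu> \<nu>. weyl_null l k \<mu> \<nu> (y - x)}"

text \<open>\<open>Weyl l k \<mu> \<nu> = 1\<^sub>\<nu> W(\<mu>)\<close>; the module \<open>W(\<mu>)\<close> is the direct sum of these spaces. It is a Weyl
  module when \<open>\<mu>\<^sub>i - \<mu>\<^bsub>i+1\<^esub> \<ge> 0\<close> for all \<open>i \<noteq> 0\<close> in \<open>Idx l k\<close>.\<close>

definition Weyl :: "nat \<Rightarrow> nat \<Rightarrow> weight \<Rightarrow> weight \<Rightarrow> free set set" where
  "Weyl l k \<mu> \<nu> = weyl_elt l k \<mu> \<nu> ` hom_free l k \<mu> \<nu>"

definition highest :: "nat \<Rightarrow> nat \<Rightarrow> weight \<Rightarrow> free set" where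
  "highest l k \<mu> = weyl_elt l k \<mu> \<mu> 1"

text \<open>The action of \<open>X \<in> Hom l k \<nu> \<rho>\<close> as a map \<open>Weyl l k \<mu> \<nu> \<rightarrow> Weyl l k \<mu> \<rho>\<close>, and scalar
  multiplication on \<open>Weyl l k \<mu> \<nu>\<close>. All members of the unions are the same class.\<close>

definition act :: "nat \<Rightarrow> nat \<Rightarrow> weight \<Rightarrow> weight \<Rightarrow> free set \<Rightarrow> free set \<Rightarrow> free set" where
  "act l k \<mu> \<rho> X V = (\<Union>x\<in>X. \<Union>v\<in>V. weyl_elt l k \<mu> \<rho> (x * v))"

definition weyl_scale :: "nat \<Rightarrow> nat \<Rightarrow> weight \<Rightarrow> weight \<Rightarrow> ground \<Rightarrow> free set \<Rightarrow> free set" where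
  "weyl_scale l k \<mu> \<nu> c V = (\<Union>v\<in>V. weyl_elt l k \<mu> \<nu> (scal c * v))"

section \<open>The element attached to a braid\<close>

text \<open>\<open>(i, True)\<close> stands for \<open>\<sigma>\<^sub>i\<close> and \<open>(i, False)\<close> for its inverse. The first letter is on top.\<close>

type_synonym braid_word = "(nat \<times> bool) list"

definition braid_words :: "nat \<Rightarrow> braid_word set" where
  "braid_words n = {b. \<forall>(i, e)\<in>set b. 1 \<le> i \<and> i < n}"

definition hw :: "nat \<Rightarrow> weight" where
  "hw n = (\<lambda>i. if i \<in> {- int n + 1..0} then (1, 0) else 0)"

definition C_elt :: "int \<Rightarrow> free" where
  "C_elt j = (\<Prod>i\<leftarrow>rev [1..j - 1]. F i * F (- i)) * F 0"

definition D_elt :: "int \<Rightarrow> free" where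
  "D_elt j = E 0 * (\<Prod>i\<leftarrow>[1..j - 1]. E i * E (- i))"

fun sigma_elt :: "nat \<times> bool \<Rightarrow> free" where
  "sigma_elt (i, True) = - (F (int i) * E (int i)) + scal (inverse qvar)"
| "sigma_elt (i, False) = scal qvar - E (int i) * F (int i)"

definition T_elt :: "braid_word \<Rightarrow> free" where
  "T_elt b = prod_list (map sigma_elt b)"

definition P_elt :: "nat \<Rightarrow> braid_word \<Rightarrow> free" where
  "P_elt n b = (\<Prod>j\<leftarrow>rev [1..int n]. D_elt j) * T_elt b * (\<Prod>j\<leftarrow>[1..int n]. C_elt j)"

section \<open>Oriented link diagrams\<close>

text \<open>A generic oriented link diagram is read from bottom to top as a sequence of layers. A layer
  \<open>(i, p)\<close> has the elementary piece \<open>p\<close> with \<open>i\<close> vertical strands to its left and vertical strands to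
  its right. \<open>Cup d\<close> is a minimum whose left leg has direction \<open>d\<close>, \<open>Cap\<close> is a maximum, and
  \<open>Cross c\<close> is a crossing of two adjacent strands, in which the strand from bottom left to top right
  is the overstrand iff \<open>c\<close>. The list of directions of the strands at a level records orientations,
  and \<open>run\<close> is undefined if the layers do not fit together.\<close>

datatype dir = Up | Down

fun flip :: "dir \<Rightarrow> dir" where
  "flip Up = Down"
| "flip Down = Up"

datatype piece = Cup dir | Cap | Cross bool

type_synonym layer = "nat \<times> piece"
type_synonym diagram = "layer list"

fun step :: "layer \<Rightarrow> dir list \<Rightarrow> dir list option" where
  "step (i, Cup d) s =
     (if i \<le> length s then Some (take i s @ [d, flip d] @ drop i s) else None)"
| "step (i, Cap) s =
     (if i + 1 < length s \<and> s ! i \<noteq> s ! (i + 1) then Some (take i s @ drop (i + 2) s) else None)"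
| "step (i, Cross c) s =
     (if i + 1 < length s then Some (s[i := s ! (i + 1), i + 1 := s ! i]) else None)"

fun run :: "diagram \<Rightarrow> dir list \<Rightarrow> dir list option" where
  "run [] s = Some s"
| "run (x # D) s = Option.bind (step x s) (run D)"

definition link_diagram :: "diagram \<Rightarrow> bool" where
  "link_diagram D \<longleftrightarrow> run D [] = Some []"

fun ins :: "piece \<Rightarrow> nat" where
  "ins (Cup d) = 0"
| "ins Cap = 2"
| "ins (Cross c) = 2"

fun outs :: "piece \<Rightarrow> nat" where
  "outs (Cup d) = 2"
| "outs Cap = 0"
| "outs (Cross c) = 2"

text \<open>Planar isotopy: change of height of distant pieces, straightening of a zigzag, and sliding a
  strand that crosses one leg of a maximum or minimum over to the other leg.\<close>

inductive planar_move :: "diagram \<Rightarrow> diagram \<Rightarrow> bool" where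
  exchange: "planar_move [(i, p), (i + outs p + m, r)] [(i + ins p + m, r), (i, p)]"
| zigzag_left: "planar_move [(i, Cup d), (i + 1, Cap)] []"
| zigzag_right: "planar_move [(i + 1, Cup d), (i, Cap)] []"
| slide_cap: "planar_move [(i, Cross c), (i + 1, Cap)] [(i + 1, Cross (\<not> c)), (i, Cap)]"
| slide_cup: "planar_move [(i + 1, Cup d), (i, Cross c)] [(i, Cup d), (i + 1, Cross (\<not> c))]"

text \<open>In \<open>R3\<close> the flags \<open>a\<close>, \<open>b\<close>, \<open>c\<close> say whether, counted from the left at the bottom, strand 1 is
  over 2, 1 over 3 and 2 over 3. The side condition excludes the two cyclic cases, in which none of
  the strands is the topmost one.\<close>

inductive reidemeister_move :: "diagram \<Rightarrow> diagram \<Rightarrow> bool" where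
  R1_right: "reidemeister_move [(i + 1, Cup d), (i, Cross c), (i + 1, Cap)] []"
| R1_left: "reidemeister_move [(i, Cup d), (i + 1, Cross c), (i, Cap)] []"
| R2: "reidemeister_move [(i, Cross c), (i, Cross (\<not> c))] []"
| R3: "\<not> (a = c \<and> a \<noteq> b) \<Longrightarrow>
    reidemeister_move [(i, Cross a), (i + 1, Cross b), (i, Cross c)]
                      [(i + 1, Cross c), (i, Cross b), (i + 1, Cross a)]"

definition elementary_isotopy :: "diagram \<Rightarrow> diagram \<Rightarrow> bool" where
  "elementary_isotopy D D' \<longleftrightarrow> link_diagram D \<and> link_diagram D' \<and>
     (\<exists>A B x y. (planar_move x y \<or> reidemeister_move x y) \<and> D = A @ x @ B \<and> D' = A @ y @ B)"

definition isotopic :: "diagram \<Rightarrow> diagram \<Rightarrow> bool" where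
  "isotopic = equivclp elementary_isotopy"

text \<open>The sign of a crossing of type \<open>c\<close> at position \<open>i\<close>, where \<open>s\<close> lists the directions just
  below it. For two upward strands it is positive iff \<open>c\<close>.\<close>

definition positive :: "dir list \<Rightarrow> nat \<Rightarrow> bool \<Rightarrow> bool" where
  "positive s i c \<longleftrightarrow> (c \<longleftrightarrow> s ! i = s ! (i + 1))"

definition writhe :: "diagram \<Rightarrow> int" where
  "writhe D = (\<Sum>m<length D. case D ! m of
       (i, Cross c) \<Rightarrow> if positive (the (run (take m D) [])) i c then 1 else - 1
     | _ \<Rightarrow> 0)"

text \<open>The smoothing which respects the orientations: vertical if both strands point the same way,
  otherwise a maximum below a minimum.\<close>

definition smoothing :: "dir list \<Rightarrow> nat \<Rightarrow> diagram" where
  "smoothing s i = (if s ! i = s ! (i + 1) then [] else [(i, Cap), (i, Cup (s ! (i + 1)))])"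

definition skein_triple :: "diagram \<Rightarrow> diagram \<Rightarrow> diagram \<Rightarrow> bool" where
  "skein_triple Lp Lm L0 \<longleftrightarrow> (\<exists>A B s i c.
     link_diagram Lp \<and> run A [] = Some s \<and> i + 1 < length s \<and> positive s i c \<and>
     Lp = A @ [(i, Cross c)] @ B \<and> Lm = A @ [(i, Cross (\<not> c))] @ B \<and> L0 = A @ smoothing s i @ B)"

definition link_invariant :: "(diagram \<Rightarrow> ground) \<Rightarrow> bool" where
  "link_invariant H \<longleftrightarrow> (\<forall>D D'. isotopic D D' \<longrightarrow> H D = H D')"

definition is_homfly_pt :: "(diagram \<Rightarrow> ground) \<Rightarrow> bool" where
  "is_homfly_pt H \<longleftrightarrow> link_invariant H \<and>
     (\<forall>d. H [(0, Cup d), (0, Cap)] = (lvar - inverse lvar) / (qvar - inverse qvar)) \<and>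
     (\<forall>Lp Lm L0. skein_triple Lp Lm L0 \<longrightarrow>
        inverse lvar * H Lp - lvar * H Lm = (inverse qvar - qvar) * H L0)"

text \<open>The braid strands point upwards, and \<open>n\<close> nested arcs close the braid on its left.\<close>

definition closure_diagram :: "nat \<Rightarrow> braid_word \<Rightarrow> diagram" where
  "closure_diagram n b =
     map (\<lambda>j. (j, Cup Down)) [0..<n]
   @ map (\<lambda>(i, e). (n + i - 1, Cross e)) (rev b)
   @ map (\<lambda>j. (j, Cap)) (rev [0..<n])"

end

theory Submission
  imports Defs
begin

text \<open>Everything happens in the quotient of the free category by the defining relations, applied to
  \<open>1\<^sub>\<mu>\<close> for \<open>\<mu> = ((\<beta>)\<^sup>n, (0)\<^sup>n)\<close>. On a weight whose entries \<open>1, \<dots>, m\<close> are all \<open>1\<close> the crossings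
  satisfy the Hecke relations. Nested cups are removed from the inside: letters \<open>\<sigma>\<^sub>i\<close> with \<open>i \<ge> 2\<close>
  commute with \<open>E\<^sub>0\<close> and \<open>F\<^sub>0\<close>, and \<open>E\<^sub>0 \<sigma>\<^sub>1 F\<^sub>0\<close> is the scalar \<open>\<lambda>\<^sup>-\<^sup>1\<close>, which is the partial trace that
  closes the first strand. What remains is \<open>P\<close> for one strand less, conjugated by the
  isomorphism that pushes the resulting entry \<open>0\<close> to the outside. Hence \<open>P(b)\<close> and the framed
  HOMFLY-PT polynomial obey the same Hecke relations and the same rule for words with at most one
  letter \<open>\<sigma>\<^sub>1\<close>, and these determine the value on every braid; the trace property is not needed.\<close>

section \<open>The module generated by the highest weight vector\<close>

text \<open>Composition in a category is partial, so the quotient is made into a module over the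
  whole free algebra, where letters of inadmissible index act by zero; equations between vectors
  then replace membership in an ideal. All cancellations have one source: an entry above beta on the
  left or below 0 on the right gives a weight outside \<open>Lambda n n\<close>, where the identity
  is zero. This turns \<open>E i * F i\<close> into a scalar and removes one term of a Serre
  relation. What survives of a Serre relation carries the factor [2] = q + 1/q, so the braid and
  sliding identities are proved up to a power of [2], which is cancelled in the field. That one
  letter of lowest index suffices is the decomposition H = H' + H' sigma_1 H' of a Hecke algebra,
  with H' generated by the other sigmas. It is applied to the difference of the two sides, so only
  vanishing has to be followed. The parameter \<open>n\<close> of the algebra stays fixed while the
  number \<open>m\<close> of strands decreases. The quotient in the Weyl module adds nothing here,
  since every weight in \<open>Lambda n n\<close> lies below \<open>hw n\<close>.\<close>

lift_definition restrict_keys :: "('a \<Rightarrow> bool) \<Rightarrow> ('a \<Rightarrow>\<^sub>0 'b::zero) \<Rightarrow> ('a \<Rightarrow>\<^sub>0 'b)"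
  is "\<lambda>P f x. if P x then f x else 0"
  by (rule finite_subset[rotated]) auto

lemma restrict_keys_zero [simp]: "restrict_keys P 0 = 0"
  by (rule poly_mapping_eqI) (simp add: restrict_keys.rep_eq)

lemma restrict_keys_add:
  fixes x y :: "'a \<Rightarrow>\<^sub>0 'b::monoid_add"
  shows "restrict_keys P (x + y) = restrict_keys P x + restrict_keys P y"
  by (rule poly_mapping_eqI) (simp add: restrict_keys.rep_eq lookup_add)

lemma restrict_keys_single:
  "restrict_keys P (Poly_Mapping.single k c) = (if P k then Poly_Mapping.single k c else 0)"
  by (rule poly_mapping_eqI) (auto simp add: restrict_keys.rep_eq lookup_single when_def)

lemma restrict_keys_id:
  "(\<And>k. k \<in> Poly_Mapping.keys x \<Longrightarrow> P k) \<Longrightarrow> restrict_keys P x = x"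
  by (rule poly_mapping_eqI) (auto simp add: restrict_keys.rep_eq in_keys_iff)

lemma restrict_keys_eq_0:
  "(\<And>k. k \<in> Poly_Mapping.keys x \<Longrightarrow> \<not> P k) \<Longrightarrow> restrict_keys P x = 0"
  by (rule poly_mapping_eqI) (auto simp add: restrict_keys.rep_eq in_keys_iff)

lemma poly_mapping_sum_single:
  "(\<Sum>k\<in>Poly_Mapping.keys x. Poly_Mapping.single k (Poly_Mapping.lookup x k)) = x"
  by (rule poly_mapping_eqI) (auto simp: lookup_sum lookup_single when_def in_keys_iff)

lemma poly_mapping_single_induct [case_names zero single add]:
  fixes x :: "'a \<Rightarrow>\<^sub>0 'b::comm_monoid_add"
  assumes 0: "P 0" and 1: "\<And>k c. P (Poly_Mapping.single k c)"
    and 2: "\<And>x y. P x \<Longrightarrow> P y \<Longrightarrow> P (x + y)"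
  shows "P x"
proof -
  have "P (\<Sum>k\<in>A. Poly_Mapping.single k (Poly_Mapping.lookup x k))" if "finite A" for A
    using that by induction (simp_all add: 0 1 2)
  from this[OF finite_keys[of x]] show ?thesis
    by (simp only: poly_mapping_sum_single)
qed

lemma restrict_keys_single_mult:
  fixes x :: free
  shows "restrict_keys P (Poly_Mapping.single w c * x)
    = Poly_Mapping.single w c * restrict_keys (\<lambda>k. P (w @ k)) x"
  by (induction x rule: poly_mapping_single_induct)
    (simp_all add: mult_single restrict_keys_single plus_list_def restrict_keys_add distrib_left)

lemma scal_mult: "scal (c * d) = scal c * scal d"
  by (simp add: scal_def mult_single plus_list_def)

lemma scal_add: "scal (c + d) = scal c + scal d"
  by (simp add: scal_def single_add)

lemma scal_diff: "scal (c - d) = scal c - scal d"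
  by (simp add: scal_def single_diff)

lemma scal_uminus: "scal (- c) = - scal c"
  by (simp add: scal_def single_uminus)

lemma scal_0 [simp]: "scal 0 = 0"
  by (simp add: scal_def)

lemma scal_1 [simp]: "scal 1 = 1"
  by (simp add: scal_def one_poly_mapping_def single.abs_eq zero_list_def when_def eq_commute)

lemma scal_commute: "scal c * x = x * scal c"
  by (induction x rule: poly_mapping_single_induct)
    (simp_all add: scal_def mult_single plus_list_def mult.commute distrib_left distrib_right)

section \<open>Words, their weights and the morphisms of the free category\<close>

abbreviation word_weight :: "gen list \<Rightarrow> weight" where
  "word_weight w \<equiv> sum_list (map gen_weight w)"

definition path :: "nat \<Rightarrow> weight \<Rightarrow> weight \<Rightarrow> gen list \<Rightarrow> bool" where
  "path n \<mu> \<nu> w \<longleftrightarrow> gen_index ` set w \<subseteq> Idx n n \<and> \<mu> + word_weight w = \<nu>"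

lemma hom_free_iff:
  "x \<in> hom_free n n \<mu> \<nu> \<longleftrightarrow> \<mu> \<in> objects n n \<and> (\<forall>w\<in>Poly_Mapping.keys x. path n \<mu> \<nu> w)"
  by (simp add: hom_free_def path_def)

lemma hom_free_0: "\<mu> \<in> objects n n \<Longrightarrow> 0 \<in> hom_free n n \<mu> \<nu>"
  by (simp add: hom_free_iff)

lemma hom_free_add:
  "x \<in> hom_free n n \<mu> \<nu> \<Longrightarrow> y \<in> hom_free n n \<mu> \<nu> \<Longrightarrow> x + y \<in> hom_free n n \<mu> \<nu>"
  using keys_add[of x y] by (auto simp: hom_free_iff)

lemma hom_free_uminus: "x \<in> hom_free n n \<mu> \<nu> \<Longrightarrow> - x \<in> hom_free n n \<mu> \<nu>"
  by (simp add: hom_free_iff)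

lemma hom_free_diff:
  "x \<in> hom_free n n \<mu> \<nu> \<Longrightarrow> y \<in> hom_free n n \<mu> \<nu> \<Longrightarrow> x - y \<in> hom_free n n \<mu> \<nu>"
  using hom_free_add[of x n \<mu> \<nu> "- y"] by (simp add: hom_free_uminus)

lemma hom_free_mult:
  "y \<in> hom_free n n \<nu> \<rho> \<Longrightarrow> x \<in> hom_free n n \<mu> \<nu> \<Longrightarrow> y * x \<in> hom_free n n \<mu> \<rho>"
  using keys_mult[of y x] by (fastforce simp: hom_free_iff path_def plus_list_def ac_simps)

lemma hom_free_single:
  "\<mu> \<in> objects n n \<Longrightarrow> path n \<mu> \<nu> w \<Longrightarrow> Poly_Mapping.single w c \<in> hom_free n n \<mu> \<nu>"
  by (simp add: hom_free_iff)

lemma hom_free_E: "\<mu> \<in> objects n n \<Longrightarrow> i \<in> Idx n n \<Longrightarrow> E i \<in> hom_free n n \<mu> (\<mu> + alpha i)"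
  by (simp add: E_def hom_free_single path_def)

lemma hom_free_F: "\<mu> \<in> objects n n \<Longrightarrow> i \<in> Idx n n \<Longrightarrow> F i \<in> hom_free n n \<mu> (\<mu> - alpha i)"
  by (simp add: F_def hom_free_single path_def)

lemma hom_free_scal: "\<mu> \<in> objects n n \<Longrightarrow> scal c \<in> hom_free n n \<mu> \<mu>"
  by (simp add: scal_def hom_free_single path_def)

lemma hom_free_1: "\<mu> \<in> objects n n \<Longrightarrow> 1 \<in> hom_free n n \<mu> \<mu>"
  using hom_free_scal[of \<mu> n 1] by simp

lemma objects_add_alpha: "\<mu> \<in> objects n n \<Longrightarrow> i \<in> Idx n n \<Longrightarrow> \<mu> + alpha i \<in> objects n n"
  by (auto simp: objects_def alpha_def Idx_def)

lemma objects_diff_alpha: "\<mu> \<in> objects n n \<Longrightarrow> i \<in> Idx n n \<Longrightarrow> \<mu> - alpha i \<in> objects n n"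
  by (auto simp: objects_def alpha_def Idx_def)

lemma objects_diff_word_weight:
  "\<nu> \<in> objects n n \<Longrightarrow> gen_index ` set w \<subseteq> Idx n n \<Longrightarrow> \<nu> - word_weight w \<in> objects n n"
proof (induction w arbitrary: \<nu>)
  case (Cons g w)
  have "\<nu> - gen_weight g \<in> objects n n"
    using Cons.prems by (cases g) (simp_all add: objects_add_alpha objects_diff_alpha)
  from Cons.IH[OF this] Cons.prems show ?case
    by (simp add: diff_diff_add)
qed simp

lemma objects_add_word_weight:
  "\<nu> \<in> objects n n \<Longrightarrow> gen_index ` set w \<subseteq> Idx n n \<Longrightarrow> \<nu> + word_weight w \<in> objects n n"
proof (induction w arbitrary: \<nu>)
  case (Cons g w)
  have "\<nu> + gen_weight g \<in> objects n n"
    using Cons.prems by (cases g) (simp_all add: objects_add_alpha objects_diff_alpha)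
  from Cons.IH[OF this] Cons.prems show ?case
    by (simp add: add.assoc)
qed simp

lemma hw_in_objects: "hw n \<in> objects n n"
  by (auto simp: hw_def objects_def)

text \<open>Cuts an element of the free algebra into components, one for each end point of paths
  from \<open>hw n\<close>, and asks that each lie in the ideal. Words with a letter outside
  \<open>Idx n n\<close> belong to no component and so count as zero; this is what makes left
  multiplication total.\<close>

definition vanishes :: "nat \<Rightarrow> free \<Rightarrow> bool" where
  "vanishes n x \<longleftrightarrow> (\<forall>\<nu>\<in>objects n n. null n n (hw n) \<nu> (restrict_keys (path n (hw n) \<nu>) x))"

lemma vanishes_0 [simp]: "vanishes n 0"
  by (simp add: vanishes_def null.zero)

lemma vanishes_add: "vanishes n x \<Longrightarrow> vanishes n y \<Longrightarrow> vanishes n (x + y)"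
  by (simp add: vanishes_def restrict_keys_add null.add)

lemma vanishes_mult: "vanishes n x \<Longrightarrow> vanishes n (y * x)"
proof (induction y rule: poly_mapping_single_induct)
  case (single w c)
  show ?case unfolding vanishes_def
  proof
    fix \<nu> assume \<nu>: "\<nu> \<in> objects n n"
    show "null n n (hw n) \<nu> (restrict_keys (path n (hw n) \<nu>) (Poly_Mapping.single w c * x))"
    proof (cases "gen_index ` set w \<subseteq> Idx n n")
      case True
      \<comment> \<open>The weight from which \<open>w\<close> has to start in order to end at
        \<nu>.\<close>
      define \<rho> where "\<rho> = \<nu> - word_weight w"
      have \<rho>: "\<rho> \<in> objects n n"
        unfolding \<rho>_def using \<nu> True by (rule objects_diff_word_weight)
      have "(\<lambda>k. path n (hw n) \<nu> (w @ k)) = path n (hw n) \<rho>"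
        using True by (intro ext) (auto simp: path_def \<rho>_def eq_diff_eq add.assoc add.commute[of "word_weight w"])
      moreover have "Poly_Mapping.single w c \<in> hom_free n n \<rho> \<nu>"
        using \<rho> True by (intro hom_free_single) (auto simp: path_def \<rho>_def)
      ultimately show ?thesis
        using single \<rho> by (auto simp: restrict_keys_single_mult vanishes_def intro: null.post)
    next
      case False
      then have "(\<lambda>k. path n (hw n) \<nu> (w @ k)) = (\<lambda>_. False)"
        by (intro ext) (auto simp: path_def)
      then have "restrict_keys (path n (hw n) \<nu>) (Poly_Mapping.single w c * x) = 0"
        by (simp add: restrict_keys_single_mult restrict_keys_eq_0)
      then show ?thesis by (simp add: null.zero)
    qed
  qed
qed (simp_all add: distrib_right vanishes_add)

lemma vanishes_uminus: "vanishes n x \<Longrightarrow> vanishes n (- x)"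
  using vanishes_mult[of n x "- 1"] by simp

lemma vanishes_diff: "vanishes n x \<Longrightarrow> vanishes n y \<Longrightarrow> vanishes n (x - y)"
  using vanishes_add[of n x "- y"] by (simp add: vanishes_uminus)

lemma path_unique: "path n \<mu> \<nu> w \<Longrightarrow> path n \<mu> \<rho> w \<Longrightarrow> \<nu> = \<rho>"
  by (simp add: path_def)

lemma hom_free_target: "x \<in> hom_free n n \<mu> \<nu> \<Longrightarrow> x \<noteq> 0 \<Longrightarrow> \<nu> \<in> objects n n"
proof -
  assume x: "x \<in> hom_free n n \<mu> \<nu>" "x \<noteq> 0"
  then obtain w where w: "w \<in> Poly_Mapping.keys x" by (metis all_not_in_conv keys_eq_empty)
  show ?thesis using x(1) w objects_add_word_weight[of \<mu> n w] by (auto simp: hom_free_iff path_def)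
qed

text \<open>A morphism is its own only component, so for morphisms nothing is lost in passing from
  the ideal to \<open>vanishes\<close>.\<close>

lemma vanishes_hom_free:
  assumes x: "x \<in> hom_free n n (hw n) \<nu>"
  shows "vanishes n x \<longleftrightarrow> null n n (hw n) \<nu> x"
proof (cases "x = 0")
  case True
  then show ?thesis by (simp add: null.zero)
next
  case False
  with x have \<nu>: "\<nu> \<in> objects n n" by (rule hom_free_target)
  have 1: "restrict_keys (path n (hw n) \<nu>) x = x"
    using x by (intro restrict_keys_id) (auto simp: hom_free_iff)
  have 2: "restrict_keys (path n (hw n) \<rho>) x = 0" if "\<rho> \<noteq> \<nu>" for \<rho>
    using x that path_unique by (intro restrict_keys_eq_0) (fastforce simp: hom_free_iff)
  show ?thesis
  proof
    show "vanishes n x \<Longrightarrow> null n n (hw n) \<nu> x"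
      using \<nu> 1 by (auto simp: vanishes_def)
    show "null n n (hw n) \<nu> x \<Longrightarrow> vanishes n x"
      unfolding vanishes_def by (metis 1 2 null.zero)
  qed
qed

definition module_rel :: "(nat \<Rightarrow> free) \<Rightarrow> (nat \<Rightarrow> free) \<Rightarrow> bool" where
  "module_rel g h \<longleftrightarrow> (\<forall>n. vanishes n (g n - h n))"

text \<open>All parameters \<open>n\<close> are treated in one type, since a type cannot depend on \<open>n\<close>.\<close>

quotient_type hmod = "nat \<Rightarrow> free" / module_rel
proof (intro equivpI reflpI sympI transpI)
  show "module_rel g g" for g by (simp add: module_rel_def)
  show "module_rel h g" if "module_rel g h" for g h
    using that vanishes_uminus[of n "g n - h n" for n] by (simp add: module_rel_def)
  show "module_rel g k" if "module_rel g h" "module_rel h k" for g h k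
    using that vanishes_add[of n "g n - h n" "h n - k n" for n] by (simp add: module_rel_def)
qed

lemma diff_diff_diff: "(a - b) - (c - d) = (a - c) - (b - d :: 'a::ab_group_add)"
  by (simp add: algebra_simps)

instantiation hmod :: ab_group_add
begin

lift_definition zero_hmod :: hmod is "\<lambda>_. 0" .

lift_definition plus_hmod :: "hmod \<Rightarrow> hmod \<Rightarrow> hmod" is "\<lambda>g h n. g n + h n"
  unfolding module_rel_def by (simp only: add_diff_add) (blast intro: vanishes_add)

lift_definition uminus_hmod :: "hmod \<Rightarrow> hmod" is "\<lambda>g n. - g n"
  unfolding module_rel_def by (simp only: minus_diff_minus) (blast intro: vanishes_uminus)

lift_definition minus_hmod :: "hmod \<Rightarrow> hmod \<Rightarrow> hmod" is "\<lambda>g h n. g n - h n"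
  unfolding module_rel_def diff_diff_diff by (blast intro: vanishes_diff)

instance
  by standard (transfer, simp add: module_rel_def)+

end

lift_definition act_on :: "free \<Rightarrow> hmod \<Rightarrow> hmod" (infixr \<open>\<star>\<close> 72) is "\<lambda>(x :: free) (g :: nat \<Rightarrow> free) n. x * g n"
  unfolding module_rel_def by (simp add: vanishes_mult flip: right_diff_distrib)

text \<open>Supported at the single parameter \<open>n\<close>, so that an equation between
  multiples of \<open>hv n\<close> speaks of the ideal for this \<open>n\<close> alone.\<close>

lift_definition hv :: "nat \<Rightarrow> hmod" is "\<lambda>n m. if m = n then 1 else 0" .

lemma act_add_right: "x \<star> (v + w) = x \<star> v + x \<star> w"
  by transfer (simp add: module_rel_def distrib_left)

lemma act_diff_right: "x \<star> (v - w) = x \<star> v - x \<star> w"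
  by transfer (simp add: module_rel_def right_diff_distrib)

lemma act_uminus_right: "x \<star> (- v) = - (x \<star> v)"
  by transfer (simp add: module_rel_def)

lemma act_0_right [simp]: "x \<star> 0 = 0"
  by transfer (simp add: module_rel_def)

lemma act_add_left: "(x + y) \<star> v = x \<star> v + y \<star> v"
  by transfer (simp add: module_rel_def distrib_right)

lemma act_diff_left: "(x - y) \<star> v = x \<star> v - y \<star> v"
  by transfer (simp add: module_rel_def left_diff_distrib)

lemma act_uminus_left: "(- x) \<star> v = - (x \<star> v)"
  by transfer (simp add: module_rel_def)

lemma act_0_left [simp]: "0 \<star> v = 0"
  by transfer (simp add: module_rel_def)

lemma act_1 [simp]: "1 \<star> v = v"
  by transfer (simp add: module_rel_def)

lemma act_mult: "(x * y) \<star> v = x \<star> y \<star> v"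
  by transfer (simp add: module_rel_def mult.assoc)

lemmas act_simps = act_add_right act_diff_right act_uminus_right
  act_add_left act_diff_left act_uminus_left act_mult

lemma act_scal: "x \<star> scal c \<star> v = scal c \<star> x \<star> v"
  by (metis act_mult scal_commute)

lemma scal_act_scal: "scal c \<star> scal d \<star> v = scal (c * d) \<star> v"
  by (simp add: scal_mult act_mult)

lemma scal_act_cancel: "c \<noteq> 0 \<Longrightarrow> scal c \<star> v = scal c \<star> w \<longleftrightarrow> v = w"
  by (metis act_1 left_inverse scal_1 scal_act_scal)

lemma act_hv_eq_0_iff: "x \<star> hv n = 0 \<longleftrightarrow> vanishes n x"
  by transfer (auto simp: module_rel_def)

definition wsp :: "nat \<Rightarrow> weight \<Rightarrow> hmod set" where
  "wsp n \<nu> = {x \<star> hv n | x. x \<in> hom_free n n (hw n) \<nu>}"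

lemma wsp_hv: "hv n \<in> wsp n (hw n)"
  unfolding wsp_def using hom_free_1[OF hw_in_objects, of n] by (metis (mono_tags, lifting) act_1 mem_Collect_eq)

lemma wsp_0: "0 \<in> wsp n \<nu>"
  unfolding wsp_def using hom_free_0[OF hw_in_objects, of n] by (metis (mono_tags, lifting) act_0_left mem_Collect_eq)

lemma wsp_act: "v \<in> wsp n \<nu> \<Longrightarrow> x \<in> hom_free n n \<nu> \<rho> \<Longrightarrow> x \<star> v \<in> wsp n \<rho>"
  unfolding wsp_def using hom_free_mult act_mult by (smt (verit) mem_Collect_eq)

text \<open>The vector 0 lies in \<open>wsp n \<nu>\<close> for every function \<nu>, whereas the
  relations are imposed at objects. A nonzero vector is reached by a word from \<open>hw n\<close>,
  so its weight is an object; this split supplies that fact wherever a relation is applied.\<close>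

lemma wsp_cases:
  assumes "v \<in> wsp n \<nu>" obtains "v = 0" | "\<nu> \<in> objects n n"
proof -
  obtain x where "x \<in> hom_free n n (hw n) \<nu>" "v = x \<star> hv n"
    using assms by (auto simp: wsp_def)
  then show thesis
    using that by (cases "x = 0") (auto dest: hom_free_target)
qed

lemma wsp_actI:
  assumes v: "v \<in> wsp n \<nu>" and x: "\<nu> \<in> objects n n \<Longrightarrow> x \<in> hom_free n n \<nu> \<rho>"
  shows "x \<star> v \<in> wsp n \<rho>"
  using v by (cases rule: wsp_cases) (simp_all add: wsp_0 wsp_act[OF v x])

lemma wsp_E: "v \<in> wsp n \<nu> \<Longrightarrow> i \<in> Idx n n \<Longrightarrow> E i \<star> v \<in> wsp n (\<nu> + alpha i)"
  by (erule wsp_actI) (rule hom_free_E)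

lemma wsp_F: "v \<in> wsp n \<nu> \<Longrightarrow> i \<in> Idx n n \<Longrightarrow> F i \<star> v \<in> wsp n (\<nu> - alpha i)"
  by (erule wsp_actI) (rule hom_free_F)

lemma wsp_scal: "v \<in> wsp n \<nu> \<Longrightarrow> scal c \<star> v \<in> wsp n \<nu>"
  by (erule wsp_actI) (rule hom_free_scal)

lemma wsp_add: "v \<in> wsp n \<nu> \<Longrightarrow> w \<in> wsp n \<nu> \<Longrightarrow> v + w \<in> wsp n \<nu>"
  unfolding wsp_def using hom_free_add act_add_left by (smt (verit) mem_Collect_eq)

lemma wsp_uminus: "v \<in> wsp n \<nu> \<Longrightarrow> - v \<in> wsp n \<nu>"
  using wsp_scal[of v n \<nu> "- 1"] by (simp add: scal_uminus act_uminus_left)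

lemma wsp_diff: "v \<in> wsp n \<nu> \<Longrightarrow> w \<in> wsp n \<nu> \<Longrightarrow> v - w \<in> wsp n \<nu>"
  using wsp_add[of v n \<nu> "- w"] by (simp add: wsp_uminus)

section \<open>The defining relations as identities between weight vectors\<close>

lemma relator_act:
  assumes v: "v \<in> wsp n \<nu>" and r: "r \<in> relators n n \<nu>" "\<nu> \<in> objects n n \<Longrightarrow> r \<in> hom_free n n \<nu> \<rho>"
  shows "r \<star> v = 0"
  using v
proof (cases rule: wsp_cases)
  case 2
  obtain x where x: "x \<in> hom_free n n (hw n) \<nu>" "v = x \<star> hv n"
    using v by (auto simp: wsp_def)
  have "null n n \<nu> \<rho> r"
    using r 2 by (auto intro: null.relator)
  then have "null n n (hw n) \<rho> (r * x)"
    using x by (auto intro: null.pre)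
  then have "vanishes n (r * x)"
    using vanishes_hom_free hom_free_mult[OF r(2)[OF 2] x(1)] by blast
  then show ?thesis
    by (simp add: x(2) act_hv_eq_0_iff flip: act_mult)
qed simp

lemma act_commutator:
  assumes v: "v \<in> wsp n \<nu>" and i: "i \<in> Idx n n" and j: "j \<in> Idx n n"
  shows "E i \<star> F j \<star> v = F j \<star> E i \<star> v
    + (if i = j then scal (qint (\<nu> i - \<nu> (i + 1))) \<star> v else 0)"
proof -
  let ?s = "if i = j then scal (qint (\<nu> i - \<nu> (i + 1))) else 0"
  have "E i * F j - F j * E i - ?s \<in> hom_free n n \<nu> (\<nu> + alpha i - alpha j)" if "\<nu> \<in> objects n n"
    using that i j hom_free_mult[OF hom_free_E[OF objects_diff_alpha[OF that j] i] hom_free_F[OF that j]]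
      hom_free_mult[OF hom_free_F[OF objects_add_alpha[OF that i] j] hom_free_E[OF that i]]
    by (intro hom_free_diff) (auto simp: algebra_simps intro: hom_free_scal hom_free_0)
  moreover have "E i * F j - F j * E i - ?s \<in> relators n n \<nu>"
    using i j unfolding relators_def by blast
  ultimately have "(E i * F j - F j * E i - ?s) \<star> v = 0"
    by (rule relator_act[OF v, rotated])
  then show ?thesis
    by (auto simp: act_simps algebra_simps)
qed

lemma hom_free_EF:
  assumes X: "X \<in> {E, F}"
  shows "\<exists>s. \<forall>i\<in>Idx n n. \<forall>\<nu>\<in>objects n n. X i \<in> hom_free n n \<nu> (\<nu> + s i) \<and> \<nu> + s i \<in> objects n n"
  using X hom_free_E hom_free_F objects_add_alpha objects_diff_alpha
  by (elim insertE) (auto intro: exI[of _ alpha] exI[of _ "\<lambda>i. - alpha i"])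

lemma act_far_commute:
  assumes v: "v \<in> wsp n \<nu>" and i: "i \<in> Idx n n" and j: "j \<in> Idx n n" and ij: "\<bar>i - j\<bar> > 1"
    and X: "X \<in> {E, F}"
  shows "X i \<star> X j \<star> v = X j \<star> X i \<star> v"
proof -
  obtain s where s: "\<And>i \<nu>. i \<in> Idx n n \<Longrightarrow> \<nu> \<in> objects n n \<Longrightarrow> X i \<in> hom_free n n \<nu> (\<nu> + s i)"
     "\<And>i \<nu>. i \<in> Idx n n \<Longrightarrow> \<nu> \<in> objects n n \<Longrightarrow> \<nu> + s i \<in> objects n n"
    using hom_free_EF[OF X] by metis
  have "X i * X j - X j * X i \<in> hom_free n n \<nu> (\<nu> + s i + s j)" if "\<nu> \<in> objects n n"
    using hom_free_mult[OF s(1)[OF i s(2)[OF j that]] s(1)[OF j that]]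
      hom_free_mult[OF s(1)[OF j s(2)[OF i that]] s(1)[OF i that]]
    by (intro hom_free_diff) (auto simp: algebra_simps)
  moreover have "X i * X j - X j * X i \<in> relators n n \<nu>"
    using i j ij X unfolding relators_def by blast
  ultimately have "(X i * X j - X j * X i) \<star> v = 0"
    by (rule relator_act[OF v, rotated])
  then show ?thesis
    by (simp add: act_simps)
qed

lemma act_serre:
  assumes v: "v \<in> wsp n \<nu>" and i: "i \<in> Idx n n" and j: "j \<in> Idx n n" and ij: "\<bar>i - j\<bar> = 1"
    and X: "X \<in> {E, F}"
  shows "X i \<star> X i \<star> X j \<star> v + X j \<star> X i \<star> X i \<star> v
    = scal (qvar + inverse qvar) \<star> X i \<star> X j \<star> X i \<star> v"
proof -
  obtain s where s: "\<And>i \<nu>. i \<in> Idx n n \<Longrightarrow> \<nu> \<in> objects n n \<Longrightarrow> X i \<in> hom_free n n \<nu> (\<nu> + s i)"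
     "\<And>i \<nu>. i \<in> Idx n n \<Longrightarrow> \<nu> \<in> objects n n \<Longrightarrow> \<nu> + s i \<in> objects n n"
    using hom_free_EF[OF X] by metis
  let ?r = "X i ^ 2 * X j + X j * X i ^ 2 - scal (qvar + inverse qvar) * X i * X j * X i"
  have "?r \<in> hom_free n n \<nu> (\<nu> + s i + s j + s i)" if \<nu>: "\<nu> \<in> objects n n"
  proof -
    note i\<nu> = s(2)[OF i \<nu>] and j\<nu> = s(2)[OF j \<nu>]
    have "X i * (X i * X j) \<in> hom_free n n \<nu> (\<nu> + s j + s i + s i)"
      "X j * (X i * X i) \<in> hom_free n n \<nu> (\<nu> + s i + s i + s j)"
      "scal (qvar + inverse qvar) * (X i * (X j * X i)) \<in> hom_free n n \<nu> (\<nu> + s i + s j + s i)"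
      by (intro hom_free_mult[OF s(1)] hom_free_mult[OF hom_free_scal] s i j \<nu>)+
    then show ?thesis
      by (intro hom_free_diff hom_free_add) (simp_all add: power2_eq_square mult.assoc algebra_simps)
  qed
  moreover have "?r \<in> relators n n \<nu>"
    using i j ij X unfolding relators_def by blast
  ultimately have "?r \<star> v = 0"
    by (rule relator_act[OF v, rotated])
  then show ?thesis
    by (simp add: act_mult act_add_left act_diff_left power2_eq_square)
qed

text \<open>Outside \<open>Lambda n n\<close> the identity is itself a relator. Every later claim
  that some product kills a vector comes from this.\<close>

lemma wsp_not_Lambda: "v \<in> wsp n \<nu> \<Longrightarrow> \<nu> \<notin> Lambda n n \<Longrightarrow> v = 0"
  using relator_act[of v n \<nu> 1 \<nu>] by (auto simp: relators_def intro: hom_free_1)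

section \<open>Relations on weight vectors\<close>

lemma qvar_nonzero: "qvar \<noteq> 0"
  by (simp add: qvar_def Zero_fract_def eq_fract)

lemma lvar_nonzero: "lvar \<noteq> 0"
  by (simp add: lvar_def Zero_fract_def eq_fract)

lemma qvar_square: "qvar * qvar \<noteq> 1" "qvar * qvar \<noteq> - 1"
  by (simp_all add: qvar_def One_fract_def eq_fract one_pCons)

lemma q_minus_inverse_nonzero: "qvar - inverse qvar \<noteq> 0"
  using qvar_square qvar_nonzero by (auto simp: field_simps)

lemma q_plus_inverse_nonzero: "qvar + inverse qvar \<noteq> 0"
  using qvar_square qvar_nonzero by (auto simp: field_simps eq_neg_iff_add_eq_0)

section \<open>Quantum integers and the tests for vanishing\<close>

abbreviation qtwo :: ground where "qtwo \<equiv> qvar + inverse qvar"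

lemma qint_0 [simp]: "qint (0, 0) = 0"
  by (simp add: qint_def qpow_def)

lemma qint_1 [simp]: "qint (0, 1) = 1"
  using q_minus_inverse_nonzero by (simp add: qint_def qpow_def power_int_minus)

lemma qint_2: "qint (0, 2) = qtwo"
  using q_minus_inverse_nonzero qvar_nonzero
  by (simp add: qint_def qpow_def power_int_minus field_simps power2_eq_square)

lemma qint_3: "qint (0, 3) + 1 = qtwo * qtwo"
  using q_minus_inverse_nonzero qvar_nonzero
  by (simp add: qint_def qpow_def power_int_minus field_simps power2_eq_square power3_eq_cube)

lemma qint_minus: "qint (0, - k) = - qint (0, k)"
  by (simp add: qint_def qpow_def power_int_minus minus_divide_left)

text \<open>The partial trace of a crossing: [beta] is the value of a free loop, [beta - 1] that of
  a loop through \<open>F 1 * E 1\<close>, and 1/q or q is the scalar part of the crossing.\<close>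

lemma qint_loop: "inverse qvar * qint (1, 0) - qint (1, - 1) = inverse lvar"
  "qvar * qint (1, 0) - qint (1, - 1) = lvar"
proof -
  have *: "c * (x / d) - y / d = z" if "c * x - y = z * d" "d \<noteq> 0" for c x y z d :: ground
    using that by (simp add: field_simps)
  show "inverse qvar * qint (1, 0) - qint (1, - 1) = inverse lvar"
    "qvar * qint (1, 0) - qint (1, - 1) = lvar"
    unfolding qint_def using qvar_nonzero lvar_nonzero
    by (intro * q_minus_inverse_nonzero; simp add: qpow_def power_int_minus algebra_simps)+
qed

lemma snd_alpha: "snd (alpha i j) = (if j = i then 1 else if j = i + 1 then - 1 else 0)"
  by (simp add: alpha_def)

lemma act_scal_EF:
  "E i \<star> scal c \<star> v = scal c \<star> E i \<star> v" "F i \<star> scal c \<star> v = scal c \<star> F i \<star> v"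
  by (rule act_scal)+

lemma wsp_negative:
  "v \<in> wsp n \<nu> \<Longrightarrow> 1 \<le> i \<Longrightarrow> i \<le> int n \<Longrightarrow> snd (\<nu> i) < 0 \<Longrightarrow> v = 0"
  by (erule wsp_not_Lambda) (auto simp: Lambda_def dest!: bspec[of _ _ i])

lemma wsp_above_beta:
  "v \<in> wsp n \<nu> \<Longrightarrow> - int n < i \<Longrightarrow> i \<le> 0 \<Longrightarrow> 0 < snd (\<nu> i) \<Longrightarrow> v = 0"
  by (erule wsp_not_Lambda) (auto simp: Lambda_def intro!: bexI[of _ i])

text \<open>Adjacent entries differ by a multiple of beta only across positions 0 and 1, so the
  integer parts and the test \<open>i = 0\<close> determine the quantum integer.\<close>

lemma act_EF:
  assumes v: "v \<in> wsp n \<nu>" and i: "i \<in> Idx n n" and d: "snd (\<nu> i) - snd (\<nu> (i + 1)) = d"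
  shows "E i \<star> F i \<star> v = F i \<star> E i \<star> v + scal (qint (if i = 0 then 1 else 0, d)) \<star> v"
  using v
proof (cases rule: wsp_cases)
  case 2
  then have "\<nu> i - \<nu> (i + 1) = (if i = 0 then 1 else 0, d)"
    using i d by (cases i "0 :: int" rule: linorder_cases)
      (auto simp: objects_def Idx_def prod_eq_iff)
  then show ?thesis
    using act_commutator[OF v i i] by simp
qed simp

definition hspace :: "nat \<Rightarrow> hmod set" where
  "hspace n = range (\<lambda>x. x \<star> hv n)"

lemma hspace_act: "v \<in> hspace n \<Longrightarrow> x \<star> v \<in> hspace n"
  by (auto simp: hspace_def simp flip: act_mult)

lemma hv_hspace: "hv n \<in> hspace n"
  unfolding hspace_def by (rule range_eqI[of _ _ 1]) simp

lemma wsp_hspace: "v \<in> wsp n \<nu> \<Longrightarrow> v \<in> hspace n"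
  by (auto simp: wsp_def hspace_def)

lemma single_bad_word:
  "\<not> gen_index ` set w \<subseteq> Idx n n \<Longrightarrow> Poly_Mapping.single w c \<star> hv n = 0"
  by (auto simp: act_hv_eq_0_iff vanishes_def restrict_keys_single path_def null.zero)

text \<open>A word with admissible letters produces a weight vector and any other word produces 0,
  so the weight vectors span.\<close>

lemma hspace_induct [consumes 1, case_names wsp zero add]:
  assumes v: "v \<in> hspace n" and 1: "\<And>v \<nu>. v \<in> wsp n \<nu> \<Longrightarrow> P v"
    and 0: "P 0" and 2: "\<And>v w. P v \<Longrightarrow> P w \<Longrightarrow> P (v + w)"
  shows "P v"
proof -
  have "P (x \<star> hv n)" for x
  proof (induction x rule: poly_mapping_single_induct)
    case (single w c)
    show ?case
    proof (cases "gen_index ` set w \<subseteq> Idx n n")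
      case True
      then have "Poly_Mapping.single w c \<in> hom_free n n (hw n) (hw n + word_weight w)"
        by (intro hom_free_single hw_in_objects) (simp add: path_def)
      then show ?thesis by (intro 1) (auto simp: wsp_def)
    qed (simp add: single_bad_word 0)
  qed (simp_all add: act_add_left 0 2)
  then show ?thesis using v by (auto simp: hspace_def)
qed

text \<open>Lets the commutation rules below be stated for all integer indices.\<close>

lemma act_bad_index:
  assumes "v \<in> hspace n" "i \<notin> Idx n n"
  shows "E i \<star> v = 0" "F i \<star> v = 0"
proof -
  have "Poly_Mapping.single [g] 1 \<star> x \<star> hv n = 0" if "gen_index g \<notin> Idx n n" for g x
  proof (induction x rule: poly_mapping_single_induct)
    case (single w c)
    have "Poly_Mapping.single (g # w) c \<star> hv n = 0"
      using that by (intro single_bad_word) auto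
    then show ?case
      by (simp add: mult_single plus_list_def flip: act_mult)
  qed (simp_all add: act_simps)
  then show "E i \<star> v = 0" "F i \<star> v = 0"
    using assms by (auto simp: hspace_def E_def F_def)
qed

section \<open>Operators that commute on the whole module\<close>

definition commute :: "nat \<Rightarrow> free \<Rightarrow> free \<Rightarrow> bool" where
  "commute n x y \<longleftrightarrow> (\<forall>v\<in>hspace n. x \<star> y \<star> v = y \<star> x \<star> v)"

lemma commuteD: "commute n x y \<Longrightarrow> v \<in> hspace n \<Longrightarrow> x \<star> y \<star> v = y \<star> x \<star> v"
  by (simp add: commute_def)

lemma commute_sym: "commute n x y \<Longrightarrow> commute n y x"
  by (simp add: commute_def)

lemma commute_mult: "commute n x y \<Longrightarrow> commute n x z \<Longrightarrow> commute n x (y * z)"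
  by (simp add: commute_def act_mult hspace_act)

lemma commute_diff: "commute n x y \<Longrightarrow> commute n x z \<Longrightarrow> commute n x (y - z)"
  by (simp add: commute_def act_simps)

lemma commute_scal: "commute n x (scal c)"
  by (simp add: commute_def act_scal)

lemma commute_1: "commute n x 1"
  by (simp add: commute_def)

lemma commute_prod_list: "(\<And>y. y \<in> set ys \<Longrightarrow> commute n x y) \<Longrightarrow> commute n x (prod_list ys)"
  by (induction ys) (simp_all add: commute_1 commute_mult)

lemma commute_EE_FF:
  assumes "X \<in> {E, F}" "\<bar>i - j\<bar> > 1"
  shows "commute n (X i) (X j)"
  unfolding commute_def
proof
  fix v assume v: "v \<in> hspace n"
  show "X i \<star> X j \<star> v = X j \<star> X i \<star> v"
  proof (cases "i \<in> Idx n n \<and> j \<in> Idx n n")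
    case True
    from v show ?thesis
    proof (induction rule: hspace_induct)
      case (wsp v \<nu>)
      then show ?case using True assms by (intro act_far_commute) auto
    qed (simp_all add: act_add_right)
  next
    case False
    then show ?thesis
      using assms(1) v by (auto simp: act_bad_index[where n = n] hspace_act)
  qed
qed

lemma commute_FF: "\<bar>i - j\<bar> > 1 \<Longrightarrow> commute n (F i) (F j)"
  by (rule commute_EE_FF) auto

lemma commute_EE: "\<bar>i - j\<bar> > 1 \<Longrightarrow> commute n (E i) (E j)"
  by (rule commute_EE_FF) auto

lemma commute_EF:
  assumes "i \<noteq> j"
  shows "commute n (E i) (F j)"
  unfolding commute_def
proof
  fix v assume v: "v \<in> hspace n"
  show "E i \<star> F j \<star> v = F j \<star> E i \<star> v"
  proof (cases "i \<in> Idx n n \<and> j \<in> Idx n n")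
    case True
    from v show ?thesis
    proof (induction rule: hspace_induct)
      case (wsp v \<nu>)
      then show ?case using True assms act_commutator[of v n \<nu> i j] by simp
    qed (simp_all add: act_add_right)
  next
    case False
    then show ?thesis
      using v by (auto simp: act_bad_index[where n = n] hspace_act)
  qed
qed

lemma commute_FE: "i \<noteq> j \<Longrightarrow> commute n (F i) (E j)"
  by (rule commute_sym[OF commute_EF]) simp

lemma Idx_pos: "1 \<le> i \<Longrightarrow> i < int n \<Longrightarrow> i \<in> Idx n n"
  by (auto simp: Idx_def)

section \<open>Quadratic, braid and sliding relations for \<open>F i * E i\<close>\<close>

lemma FE_square:
  assumes v: "v \<in> wsp n \<nu>" and i: "1 \<le> i" "i < int n" and \<nu>: "snd (\<nu> i) = 1" "snd (\<nu> (i + 1)) = 1"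
  shows "F i \<star> E i \<star> F i \<star> E i \<star> v = scal qtwo \<star> F i \<star> E i \<star> v"
proof -
  note I = Idx_pos[OF i]
  \<comment> \<open>The entry at \<open>i + 1\<close> would become -1. After one \<open>E i\<close>
    the two entries are 2 and 0, whence the factor [2].\<close>
  have "E i \<star> E i \<star> v = 0"
    using i \<nu> by (intro wsp_negative[OF wsp_E[OF wsp_E[OF v I] I], of "i + 1"]) (auto simp: snd_alpha)
  then have "E i \<star> F i \<star> E i \<star> v = scal qtwo \<star> E i \<star> v"
    using act_EF[OF wsp_E[OF v I] I, of 2] i \<nu> by (simp add: snd_alpha qint_2)
  then show ?thesis by (simp add: act_scal_EF)
qed

text \<open>In divided powers this is F^(2) E^(2) = E F at the entries (1, 2). There
  \<open>F i\<close> acts at most once without vanishing, and moving \<open>F i\<close> to the right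
  past both \<open>E i\<close> leaves the coefficient [3] + 1 = [2]^2.\<close>

lemma FFEE:
  assumes w: "w \<in> wsp n \<nu>" and i: "1 \<le> i" "i < int n" and \<nu>: "snd (\<nu> i) = 1" "snd (\<nu> (i + 1)) = 2"
  shows "F i \<star> F i \<star> E i \<star> E i \<star> w = scal (qtwo * qtwo) \<star> E i \<star> F i \<star> w"
proof -
  note I = Idx_pos[OF i]
  have FF: "F i \<star> F i \<star> w = 0"
    using i \<nu> by (intro wsp_negative[OF wsp_F[OF wsp_F[OF w I] I], of i]) (auto simp: snd_alpha)
  have 1: "F i \<star> E i \<star> F i \<star> w = scal (qint (0, 3)) \<star> F i \<star> w"
    using act_EF[OF wsp_F[OF w I] I, of "- 3"] i \<nu> FF
    by (simp add: snd_alpha qint_minus scal_uminus act_uminus_left)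
  have 2: "F i \<star> E i \<star> E i \<star> w = E i \<star> F i \<star> E i \<star> w - E i \<star> w"
    using act_EF[OF wsp_E[OF w I] I, of 1] i \<nu> by (simp add: snd_alpha)
  have 3: "F i \<star> E i \<star> w = E i \<star> F i \<star> w + w"
    using act_EF[OF w I, of "- 1"] i \<nu> qint_minus[of 1]
    by (simp add: scal_uminus act_uminus_left)
  have 4: "F i \<star> E i \<star> E i \<star> F i \<star> w = E i \<star> F i \<star> E i \<star> F i \<star> w + E i \<star> F i \<star> w"
    using act_EF[OF wsp_E[OF wsp_F[OF w I] I] I, of "- 1"] i \<nu> qint_minus[of 1]
    by (simp add: snd_alpha scal_uminus act_uminus_left)
  have "F i \<star> F i \<star> E i \<star> E i \<star> w = F i \<star> E i \<star> E i \<star> F i \<star> w"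
    by (simp add: 2 3 act_simps)
  also have "\<dots> = scal (qint (0, 3) + 1) \<star> E i \<star> F i \<star> w"
    by (simp only: 4 1 act_scal_EF scal_add act_add_left scal_1 act_1)
  finally show ?thesis by (simp only: qint_3)
qed

text \<open>The left side reduces to \<open>F i * F j * F i * E i * E j * E i\<close> and the right
  side to \<open>F j * E i * F i * E j\<close>, applied to \<open>v\<close>. Times [2]^2 both become
  \<open>F j * F i * F i * E i * E i * E j\<close>: the first by the Serre relations for
  \<open>F\<close> and \<open>E\<close>, each with one term missing, the second by
  \<open>FFEE\<close>. Then [2]^2 is cancelled.\<close>

lemma FE_braid:
  assumes v: "v \<in> wsp n \<nu>" and i: "1 \<le> i" "i + 1 < int n"
    and \<nu>: "snd (\<nu> i) = 1" "snd (\<nu> (i + 1)) = 1" "snd (\<nu> (i + 2)) = 1" and j: "j = i + 1"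
  shows "F i \<star> E i \<star> F j \<star> E j \<star> F i \<star> E i \<star> v - F i \<star> E i \<star> v
       = F j \<star> E j \<star> F i \<star> E i \<star> F j \<star> E j \<star> v - F j \<star> E j \<star> v"
proof -
  have I: "i \<in> Idx n n" and J: "j \<in> Idx n n"
    using i j by (auto simp: Idx_def)
  have cEF: "E i \<star> F j \<star> x = F j \<star> E i \<star> x" "E j \<star> F i \<star> x = F i \<star> E j \<star> x" if "x \<in> hspace n" for x
    using that j commute_EF[of i j n] commute_EF[of j i n] by (auto intro: commuteD)
  define z where "z = E i \<star> v"
  have z: "z \<in> wsp n (\<nu> + alpha i)" unfolding z_def by (rule wsp_E[OF v I])
  define u where "u = E j \<star> z"
  have u: "u \<in> wsp n (\<nu> + alpha i + alpha j)" unfolding u_def by (rule wsp_E[OF z J])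
  have "F j \<star> z = 0"
    using i j \<nu> by (intro wsp_negative[OF wsp_F[OF z J], of j]) (auto simp: snd_alpha)
  then have Fu: "F j \<star> u = z"
    using act_EF[OF z J, of "- 1"] i j \<nu> qint_minus[of 1]
    by (simp add: snd_alpha scal_uminus act_uminus_left u_def algebra_simps)
  have EFu: "E i \<star> F i \<star> u = F i \<star> E i \<star> u + u"
    using act_EF[OF u I, of 1] i j \<nu> by (simp add: snd_alpha)
  have "F i \<star> E i \<star> F j \<star> E j \<star> F i \<star> z = F i \<star> F j \<star> E i \<star> F i \<star> u"
    by (simp add: u_def cEF hspace_act wsp_hspace[OF z])
  also have "\<dots> = F i \<star> F j \<star> F i \<star> E i \<star> u + F i \<star> z"
    by (simp add: EFu act_simps Fu)
  finally have 1: "F i \<star> E i \<star> F j \<star> E j \<star> F i \<star> E i \<star> v - F i \<star> E i \<star> v = F i \<star> F j \<star> F i \<star> E i \<star> u"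
    by (simp add: z_def)
  have s: "E i \<star> u \<in> wsp n (\<nu> + alpha i + alpha j + alpha i)"
    by (rule wsp_E[OF u I])
  \<comment> \<open>The entries from \<open>i\<close> to \<open>i + 2\<close> are now 3, 0, 0, so
    \<open>F j\<close> would make one negative and the Serre relation keeps a single outer
    term.\<close>
  have "F j \<star> E i \<star> u = 0"
    using i j \<nu> by (intro wsp_negative[OF wsp_F[OF s J], of j]) (auto simp: snd_alpha)
  then have 2: "scal qtwo \<star> F i \<star> F j \<star> F i \<star> E i \<star> u = F j \<star> F i \<star> F i \<star> E i \<star> u"
    using act_serre[OF s I J, of F] j by simp
  have "E i \<star> E i \<star> v = 0"
    using i \<nu> by (intro wsp_negative[OF wsp_E[OF wsp_E[OF v I] I], of "i + 1"]) (auto simp: snd_alpha)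
  then have 3: "scal qtwo \<star> E i \<star> u = E i \<star> E i \<star> E j \<star> v"
    using act_serre[OF v I J, of E] j by (simp add: u_def z_def)
  have 4: "scal (qtwo * qtwo) \<star> F i \<star> F j \<star> F i \<star> E i \<star> u = F j \<star> F i \<star> F i \<star> E i \<star> E i \<star> E j \<star> v"
    by (simp only: scal_mult act_mult 2) (simp only: 3[symmetric] act_scal_EF)
  define w where "w = E j \<star> v"
  have w: "w \<in> wsp n (\<nu> + alpha j)" unfolding w_def by (rule wsp_E[OF v J])
  have "E j \<star> E i \<star> w = 0"
    using i j \<nu> by (intro wsp_negative[OF wsp_E[OF wsp_E[OF w I] J], of "i + 2"]) (auto simp: snd_alpha)
  then have EF: "E j \<star> F j \<star> E i \<star> w = E i \<star> w"
    using act_EF[OF wsp_E[OF w I] J, of 1] i j \<nu> by (simp add: snd_alpha add.commute[of i 2])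
  have FE: "F i \<star> E i \<star> w = E i \<star> F i \<star> w + w"
    using act_EF[OF w I, of "- 1"] i j \<nu> qint_minus[of 1]
    by (simp add: snd_alpha scal_uminus act_uminus_left)
  have "F j \<star> E j \<star> F i \<star> E i \<star> F j \<star> w = F j \<star> F i \<star> E j \<star> F j \<star> E i \<star> w"
    by (simp add: cEF hspace_act wsp_hspace[OF w])
  also have "\<dots> = F j \<star> E i \<star> F i \<star> w + F j \<star> w"
    by (simp add: EF FE act_simps)
  finally have 5: "F j \<star> E j \<star> F i \<star> E i \<star> F j \<star> E j \<star> v - F j \<star> E j \<star> v = F j \<star> E i \<star> F i \<star> w"
    by (simp add: w_def)
  have "F i \<star> F i \<star> E i \<star> E i \<star> w = scal (qtwo * qtwo) \<star> E i \<star> F i \<star> w"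
    using i j \<nu> by (intro FFEE[OF w]) (auto simp: snd_alpha)
  then have "scal (qtwo * qtwo) \<star> F j \<star> E i \<star> F i \<star> w = scal (qtwo * qtwo) \<star> F i \<star> F j \<star> F i \<star> E i \<star> u"
    by (simp add: 4 act_scal_EF flip: w_def)
  then have "F j \<star> E i \<star> F i \<star> w = F i \<star> F j \<star> F i \<star> E i \<star> u"
    using q_plus_inverse_nonzero by (subst (asm) scal_act_cancel) auto
  then show ?thesis by (simp only: 1 5)
qed

text \<open>Both sides equal \<open>F j * F i\<close> applied to \<open>y\<close>.
  \<open>F i * F j\<close> moves the entry 0 from the right end of (1, 1, 0) to the left end; the
  two 1s, and a crossing on them, shift one place to the right.\<close>

lemma FE_slide:
  assumes y: "y \<in> wsp n \<nu>" and i: "1 \<le> i" "i + 1 < int n"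
    and \<nu>: "snd (\<nu> i) = 1" "snd (\<nu> (i + 1)) = 1" "snd (\<nu> (i + 2)) = 0" and j: "j = i + 1"
  shows "F j \<star> E j \<star> F i \<star> F j \<star> y = F i \<star> F j \<star> F i \<star> E i \<star> y"
proof -
  have I: "i \<in> Idx n n" and J: "j \<in> Idx n n"
    using i j by (auto simp: Idx_def)
  have "E j \<star> y = 0"
    using i j \<nu> by (intro wsp_negative[OF wsp_E[OF y J], of "i + 2"]) (auto simp: snd_alpha)
  then have 1: "E j \<star> F j \<star> y = y"
    using act_EF[OF y J, of 1] i j \<nu> by (simp add: add.commute[of i 2])
  have "E j \<star> F i \<star> F j \<star> y = F i \<star> E j \<star> F j \<star> y"
    using j commuteD[OF commute_EF[of j i n]] hspace_act[OF wsp_hspace[OF y]] by simp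
  then have 2: "F j \<star> E j \<star> F i \<star> F j \<star> y = F j \<star> F i \<star> y"
    by (simp add: 1)
  define z where "z = E i \<star> y"
  have z: "z \<in> wsp n (\<nu> + alpha i)" unfolding z_def by (rule wsp_E[OF y I])
  have "F j \<star> z = 0"
    using i j \<nu> by (intro wsp_negative[OF wsp_F[OF z J], of j]) (auto simp: snd_alpha)
  then have 3: "scal qtwo \<star> F i \<star> F j \<star> F i \<star> z = F j \<star> F i \<star> F i \<star> z"
    using act_serre[OF z I J, of F] j by simp
  have 4: "F i \<star> z = E i \<star> F i \<star> y"
    using act_EF[OF y I, of 0] i \<nu> by (simp add: z_def)
  have "F i \<star> F i \<star> y = 0"
    using i \<nu> by (intro wsp_negative[OF wsp_F[OF wsp_F[OF y I] I], of i]) (auto simp: snd_alpha)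
  then have "F i \<star> E i \<star> F i \<star> y = scal qtwo \<star> F i \<star> y"
    using act_EF[OF wsp_F[OF y I] I, of "- 2"] i \<nu>
    by (simp add: snd_alpha qint_minus qint_2 scal_uminus act_uminus_left del: minus_add_distrib)
  then have "scal qtwo \<star> F i \<star> F j \<star> F i \<star> z = scal qtwo \<star> F j \<star> F i \<star> y"
    unfolding 3 by (simp add: 4 act_scal_EF)
  then have "F i \<star> F j \<star> F i \<star> z = F j \<star> F i \<star> y"
    using q_plus_inverse_nonzero by (simp add: scal_act_cancel)
  then show ?thesis by (simp only: 2 z_def)
qed

section \<open>Values of the innermost loop\<close>

lemma loop_empty:
  assumes y: "y \<in> wsp n \<nu>" and n: "1 \<le> n" and \<nu>: "snd (\<nu> 0) = 0" "snd (\<nu> 1) = 0"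
  shows "E 0 \<star> F 0 \<star> y = scal (qint (1, 0)) \<star> y"
proof -
  have I: "0 \<in> Idx n n" using n by (auto simp: Idx_def)
  have "E 0 \<star> y = 0"
    using n \<nu> by (intro wsp_above_beta[OF wsp_E[OF y I], of 0]) (auto simp: snd_alpha)
  then show ?thesis
    using act_EF[OF y I, of 0] \<nu> by simp
qed

text \<open>\<open>E 1\<close> and \<open>F 1\<close> commute with \<open>F 0\<close> and
  \<open>E 0\<close> respectively, so the loop is evaluated between them. There the entry at 1 is 1
  instead of 0, which changes [beta] to [beta - 1], and the remaining \<open>F 1 * E 1\<close> is
  the identity on \<open>y\<close>.\<close>

lemma loop_FE:
  assumes y: "y \<in> wsp n \<nu>" and n: "2 \<le> n" and \<nu>: "snd (\<nu> 0) = 0" "snd (\<nu> 1) = 0" "snd (\<nu> 2) = 1"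
  shows "E 0 \<star> F 1 \<star> E 1 \<star> F 0 \<star> y = scal (qint (1, - 1)) \<star> y"
proof -
  have I: "0 \<in> Idx n n" and J: "1 \<in> Idx n n" using n by (auto simp: Idx_def)
  note hs = hspace_act wsp_hspace[OF y]
  define u where "u = E 1 \<star> y"
  have u: "u \<in> wsp n (\<nu> + alpha 1)" unfolding u_def by (rule wsp_E[OF y J])
  have "E 0 \<star> F 1 \<star> E 1 \<star> F 0 \<star> y = F 1 \<star> E 0 \<star> F 0 \<star> u"
    by (simp add: u_def hs commuteD[OF commute_EF[of 1 0 n]] commuteD[OF commute_EF[of 0 1 n]])
  moreover have "E 0 \<star> u = 0"
    using n \<nu> by (intro wsp_above_beta[OF wsp_E[OF u I], of 0]) (auto simp: snd_alpha)
  then have "E 0 \<star> F 0 \<star> u = scal (qint (1, - 1)) \<star> u"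
    using act_EF[OF u I, of "- 1"] \<nu> by (simp add: snd_alpha)
  moreover have "F 1 \<star> y = 0"
    using n \<nu> by (intro wsp_negative[OF wsp_F[OF y J], of 1]) (auto simp: snd_alpha)
  then have "F 1 \<star> u = y"
    using act_EF[OF y J, of "- 1"] \<nu> qint_minus[of 1]
    by (simp add: u_def scal_uminus act_uminus_left)
  ultimately show ?thesis by (simp add: act_scal_EF)
qed

section \<open>Cups and caps\<close>

abbreviation FF_elt :: "int \<Rightarrow> free" where "FF_elt j \<equiv> F j * F (- j)"
abbreviation EE_elt :: "int \<Rightarrow> free" where "EE_elt j \<equiv> E j * E (- j)"

text \<open>The factor of index \<open>m\<close> acts first. \<open>push m\<close> carries the
  unoccupied pair of entries from outside \<open>m\<close> nested strands to the centre and so makes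
  room for a new innermost cup; \<open>pull m\<close> undoes it.\<close>

definition push :: "nat \<Rightarrow> free" where "push m = (\<Prod>j\<leftarrow>[1..int m]. FF_elt j)"
definition pull :: "nat \<Rightarrow> free" where "pull m = (\<Prod>j\<leftarrow>rev [1..int m]. EE_elt j)"
definition cups :: "nat \<Rightarrow> free" where "cups m = (\<Prod>j\<leftarrow>[1..int m]. C_elt j)"
definition caps :: "nat \<Rightarrow> free" where "caps m = (\<Prod>j\<leftarrow>rev [1..int m]. D_elt j)"
definition outer_cups :: "nat \<Rightarrow> free" where "outer_cups m = (\<Prod>j\<leftarrow>[2..1 + int m]. C_elt j)"
definition outer_caps :: "nat \<Rightarrow> free" where "outer_caps m = (\<Prod>j\<leftarrow>rev [2..1 + int m]. D_elt j)"

lemma upto_snoc: "[1..1 + int m] = [1..int m] @ [1 + int m]" "[2..2 + int m] = [2..1 + int m] @ [2 + int m]"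
  by (simp_all add: upto_rec2)

lemma C_elt_Suc: "C_elt (2 + int m) = FF_elt (1 + int m) * C_elt (1 + int m)"
  by (simp add: C_elt_def upto_snoc mult.assoc)

lemma D_elt_Suc: "D_elt (2 + int m) = D_elt (1 + int m) * EE_elt (1 + int m)"
  by (simp add: D_elt_def upto_snoc mult.assoc)

text \<open>The letters of \<open>cups m\<close> have indices between \<open>1 - m\<close> and
  \<open>m - 1\<close>, at distance at least 2 from \<open>m + 1\<close> and
  \<open>- m - 1\<close>.\<close>

lemma commute_FF_cups: "commute n (cups m) (FF_elt (1 + int m))"
proof -
  have "commute n (F k) (cups m)" if "\<bar>k\<bar> = 1 + int m" for k
  proof -
    have "k = 1 + int m \<or> k = - (1 + int m)" using that by arith
    then show ?thesis
      unfolding cups_def C_elt_def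
      by (intro commute_prod_list) (auto intro!: commute_mult commute_prod_list commute_FF)
  qed
  then show ?thesis
    by (intro commute_mult[OF commute_sym commute_sym]) auto
qed

lemma commute_EE_caps: "commute n (EE_elt (1 + int m)) (caps m)"
proof -
  have "commute n (E k) (caps m)" if "\<bar>k\<bar> = 1 + int m" for k
  proof -
    have "k = 1 + int m \<or> k = - (1 + int m)" using that by arith
    then show ?thesis
      unfolding caps_def D_elt_def
      by (intro commute_prod_list) (auto intro!: commute_mult commute_prod_list commute_EE)
  qed
  then show ?thesis
    by (intro commute_sym[OF commute_mult[OF commute_sym commute_sym]]) auto
qed

text \<open>Each \<open>C_elt (j + 1)\<close> is \<open>FF_elt j * C_elt j\<close>. The
  \<open>FF_elt\<close> factors commute past the shorter cups to their left and collect to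
  \<open>push m\<close>.\<close>

lemma outer_cups_eq: "v \<in> hspace n \<Longrightarrow> outer_cups m \<star> v = push m \<star> cups m \<star> v"
proof (induction m arbitrary: v)
  case (Suc m)
  have "outer_cups (Suc m) = outer_cups m * C_elt (2 + int m)"
    by (simp add: outer_cups_def upto_snoc)
  then have "outer_cups (Suc m) \<star> v = push m \<star> cups m \<star> FF_elt (1 + int m) \<star> C_elt (1 + int m) \<star> v"
    using Suc by (simp add: act_mult C_elt_Suc hspace_act)
  also have "cups m \<star> FF_elt (1 + int m) \<star> C_elt (1 + int m) \<star> v
      = FF_elt (1 + int m) \<star> cups m \<star> C_elt (1 + int m) \<star> v"
    by (rule commuteD[OF commute_FF_cups hspace_act[OF Suc.prems]])
  finally show ?case
    by (simp add: push_def cups_def upto_snoc act_mult)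
qed (simp add: outer_cups_def push_def cups_def)

lemma outer_caps_eq: "v \<in> hspace n \<Longrightarrow> outer_caps m \<star> v = caps m \<star> pull m \<star> v"
proof (induction m arbitrary: v)
  case (Suc m)
  have "outer_caps (Suc m) = D_elt (2 + int m) * outer_caps m"
    by (simp add: outer_caps_def upto_snoc)
  then have "outer_caps (Suc m) \<star> v = D_elt (1 + int m) \<star> EE_elt (1 + int m) \<star> caps m \<star> pull m \<star> v"
    using Suc by (simp add: act_mult D_elt_Suc hspace_act)
  also have "EE_elt (1 + int m) \<star> caps m \<star> pull m \<star> v = caps m \<star> EE_elt (1 + int m) \<star> pull m \<star> v"
    by (rule commuteD[OF commute_EE_caps hspace_act[OF Suc.prems]])
  finally show ?case
    by (simp add: pull_def caps_def upto_snoc act_mult)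
qed (simp add: outer_caps_def pull_def caps_def)

text \<open>The weight after \<open>m\<close> nested cups, with the entries at \<open>1 - k\<close> and \<open>k\<close> reset to \<open>\<beta>\<close>
  and \<open>0\<close>. For \<open>k = m + 1\<close> this is the weight at the bottom of a braid on \<open>m\<close> strands.\<close>

definition hole_weight :: "nat \<Rightarrow> int \<Rightarrow> int \<Rightarrow> weight" where
  "hole_weight n m k = (\<lambda>i.
     if - int n < i \<and> i \<le> 0 then (1, if - m \<le> i \<and> i \<noteq> 1 - k then - 1 else 0)
     else if 1 \<le> i \<and> i \<le> int n then (0, if i \<le> m + 1 \<and> i \<noteq> k then 1 else 0) else 0)"

lemma fst_hole_weight: "fst (hole_weight n m k i) = (if - int n < i \<and> i \<le> 0 then 1 else 0)"
  by (simp add: hole_weight_def)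

lemma snd_hole_weight: "snd (hole_weight n m k i) =
   (if - int n < i \<and> i \<le> 0 then if - m \<le> i \<and> i \<noteq> 1 - k then - 1 else 0
    else if 1 \<le> i \<and> i \<le> int n then if i \<le> m + 1 \<and> i \<noteq> k then 1 else 0 else 0)"
  by (simp add: hole_weight_def)

lemma fst_alpha: "fst (alpha i j) = 0"
  by (simp add: alpha_def)

lemma hole_weight_0: "hole_weight n 0 1 = hw n"
  by (rule ext) (auto simp: hole_weight_def hw_def zero_prod_def)

lemma hole_weight_step:
  assumes "1 \<le> k" "k \<le> m" "m < int n"
  shows "hole_weight n m (k + 1) - alpha (- k) - alpha k = hole_weight n m k"
proof (rule ext, rule prod_eqI)
  fix i
  show "snd ((hole_weight n m (k + 1) - alpha (- k) - alpha k) i) = snd (hole_weight n m k i)"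
    using assms unfolding fun_diff_def snd_diff snd_hole_weight snd_alpha by (auto split: if_splits)
qed (simp add: fst_hole_weight fst_alpha)

text \<open>The new cup fills the central hole. For \<open>m + 1\<close> strands the hole at
  \<open>m + 2\<close> is outside all strands, so the induction over the cups closes up.\<close>

lemma hole_weight_cup:
  assumes "0 \<le> m" "m < int n"
  shows "hole_weight n m 1 - alpha 0 = hole_weight n (m + 1) (m + 2)"
proof (rule ext, rule prod_eqI)
  fix i
  show "snd ((hole_weight n m 1 - alpha 0) i) = snd (hole_weight n (m + 1) (m + 2) i)"
    using assms unfolding fun_diff_def snd_diff snd_hole_weight snd_alpha by (smt (verit))
qed (simp add: fst_hole_weight fst_alpha)

lemma snd_hole_weight_pos:
  "1 \<le> i \<Longrightarrow> i \<le> int n \<Longrightarrow> snd (hole_weight n m k i) = (if i \<le> m + 1 \<and> i \<noteq> k then 1 else 0)"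
  by (simp add: hole_weight_def)

lemma snd_hole_weight_nonpos:
  "- int n < i \<Longrightarrow> i \<le> 0 \<Longrightarrow> snd (hole_weight n m k i) = (if - m \<le> i \<and> i \<noteq> 1 - k then - 1 else 0)"
  by (simp add: hole_weight_def)

lemma wsp_FF_elt:
  assumes y: "y \<in> wsp n (hole_weight n m (k + 1))" and k: "1 \<le> k" "k \<le> m" "m < int n"
  shows "FF_elt k \<star> y \<in> wsp n (hole_weight n m k)"
proof -
  have I: "k \<in> Idx n n" "- k \<in> Idx n n" using k by (auto simp: Idx_def)
  show ?thesis
    using wsp_F[OF wsp_F[OF y I(2)] I(1)] by (simp add: act_mult hole_weight_step[OF k])
qed

text \<open>Downward induction on \<open>k\<close>, because the factor of largest index acts first;
  each factor moves the hole one place inwards.\<close>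

lemma wsp_push_from:
  assumes y: "y \<in> wsp n (hole_weight n m (m + 1))" and k: "1 \<le> k" "m < int n" "k \<le> m + 1"
  shows "(\<Prod>j\<leftarrow>[k..m]. FF_elt j) \<star> y \<in> wsp n (hole_weight n m k)"
  using k(3,1)
proof (induction k rule: int_le_induct)
  case (step k)
  then have "[k - 1..m] = (k - 1) # [k..m]" by (simp add: upto_rec1)
  with step k wsp_FF_elt[of _ n m "k - 1"] show ?case by (simp add: act_mult)
qed (use y in simp)

lemma wsp_push: "y \<in> wsp n (hole_weight n (int m) (int m + 1)) \<Longrightarrow> m < n \<Longrightarrow> push m \<star> y \<in> wsp n (hole_weight n (int m) 1)"
  unfolding push_def by (rule wsp_push_from) auto

lemma cups_Suc: "cups (Suc m) = F 0 * outer_cups m"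
proof -
  have "[1..1 + int m] = 1 # [2..1 + int m]" by (simp add: upto_rec1)
  then show ?thesis by (simp add: cups_def outer_cups_def C_elt_def)
qed

lemma caps_Suc: "caps (Suc m) = outer_caps m * E 0"
proof -
  have "[1..1 + int m] = 1 # [2..1 + int m]" by (simp add: upto_rec1)
  then show ?thesis by (simp add: caps_def outer_caps_def D_elt_def)
qed

lemma wsp_cups: "m \<le> n \<Longrightarrow> cups m \<star> hv n \<in> wsp n (hole_weight n (int m) (int m + 1))"
proof (induction m)
  case 0
  then show ?case using wsp_hv[of n] by (simp add: cups_def hole_weight_0)
next
  case (Suc m)
  then have "push m \<star> cups m \<star> hv n \<in> wsp n (hole_weight n (int m) 1)"
    by (intro wsp_push) auto
  from wsp_F[OF this, of 0] hole_weight_cup[of "int m" n] Suc.prems show ?case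
    by (simp add: cups_Suc act_mult outer_cups_eq[OF hv_hspace] Idx_def ac_simps)
qed

text \<open>Next to the hole the entries differ by exactly 1 and \<open>E\<close> would leave
  \<open>Lambda n n\<close>, so on either side \<open>E\<close> after \<open>F\<close> is [1] =
  1.\<close>

lemma EE_FF_cancel:
  assumes y: "y \<in> wsp n (hole_weight n m (k + 1))" and k: "1 \<le> k" "k \<le> m" "m < int n"
  shows "EE_elt k \<star> FF_elt k \<star> y = y"
proof -
  have I: "k \<in> Idx n n" "- k \<in> Idx n n" using k by (auto simp: Idx_def)
  have "E (- k) \<star> y = 0"
    using k by (intro wsp_above_beta[OF wsp_E[OF y I(2)], of "- k"]) (auto simp: snd_alpha snd_hole_weight_nonpos)
  then have 1: "E (- k) \<star> F (- k) \<star> y = y"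
    using act_EF[OF y I(2), of 1] k by (simp add: snd_hole_weight_nonpos)
  have "E k \<star> y = 0"
    using k by (intro wsp_negative[OF wsp_E[OF y I(1)], of "k + 1"]) (auto simp: snd_alpha snd_hole_weight_pos)
  then have 2: "E k \<star> F k \<star> y = y"
    using act_EF[OF y I(1), of 1] k by (simp add: snd_hole_weight_pos)
  have "EE_elt k \<star> FF_elt k \<star> y = E k \<star> F k \<star> E (- k) \<star> F (- k) \<star> y"
    using commuteD[OF commute_EF[of "- k" k n], of "F (- k) \<star> y"] k wsp_hspace[OF y]
    by (simp add: act_mult hspace_act)
  then show ?thesis by (simp only: 1 2)
qed

lemma pull_push_from:
  assumes y: "y \<in> wsp n (hole_weight n m (m + 1))" and k: "1 \<le> k" "m < int n" "k \<le> m + 1"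
  shows "(\<Prod>j\<leftarrow>rev [k..m]. EE_elt j) \<star> (\<Prod>j\<leftarrow>[k..m]. FF_elt j) \<star> y = y"
  using k(3,1)
proof (induction k rule: int_le_induct)
  case (step k)
  then have "[k - 1..m] = (k - 1) # [k..m]" by (simp add: upto_rec1)
  with step k EE_FF_cancel[of _ n m "k - 1"] wsp_push_from[OF y, of k] show ?case
    by (simp add: act_mult)
qed simp

lemma pull_push:
  "y \<in> wsp n (hole_weight n (int m) (int m + 1)) \<Longrightarrow> m < n \<Longrightarrow> pull m \<star> push m \<star> y = y"
  unfolding push_def pull_def by (rule pull_push_from) auto

text \<open>Only the factors \<open>FF_elt i\<close> and \<open>FF_elt j\<close> interact with the
  crossing: those of smaller index are far from \<open>j\<close>, those of larger index are far from
  \<open>i\<close>. The middle pair is \<open>FE_slide\<close>.\<close>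

lemma FE_push:
  assumes y: "y \<in> wsp n (hole_weight n (int m) (int m + 1))" and i: "1 \<le> i" "i + 1 \<le> int m" "m < n"
    and j: "j = i + 1"
  shows "F j \<star> E j \<star> push m \<star> y = push m \<star> F i \<star> E i \<star> y"
proof -
  define A where "A = (\<Prod>j\<leftarrow>[1..i - 1]. FF_elt j)"
  define B where "B = (\<Prod>k\<leftarrow>[j + 1..int m]. FF_elt k)"
  have "[1..int m] = [1..i - 1] @ i # j # [j + 1..int m]"
    using i j upto_split2[of 1 "i - 1" "int m"] upto_rec1[of i "int m"] upto_rec1[of j "int m"]
    by (cases "i = 1") simp_all
  then have push: "push m = A * FF_elt i * FF_elt j * B"
    by (simp add: push_def A_def B_def mult.assoc)
  have A: "commute n A (F j)" "commute n A (E j)"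
    unfolding A_def by (rule commute_sym[OF commute_prod_list];
      use i j in \<open>auto intro!: commute_mult commute_FF commute_EF\<close>)+
  have B: "commute n (F i) B" "commute n (E i) B"
    unfolding B_def by (rule commute_prod_list;
      use i j in \<open>auto intro!: commute_mult commute_FF commute_EF\<close>)+
  note hs = hspace_act wsp_hspace[OF y]
  have z: "B \<star> y \<in> wsp n (hole_weight n (int m) (j + 1))"
    unfolding B_def using i j by (intro wsp_push_from y) auto
  \<comment> \<open>The letters of negative index are made to act first. They leave the entries at
    positive positions alone, so \<open>FE_slide\<close> applies to the result, and they commute
    with all letters of index \<open>i\<close> and \<open>j\<close>.\<close>
  define z' where "z' = F (- i) \<star> F (- j) \<star> B \<star> y"
  define \<nu> where "\<nu> = hole_weight n (int m) (j + 1) - alpha (- j) - alpha (- i)"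
  have z': "z' \<in> wsp n \<nu>"
    unfolding z'_def \<nu>_def using i j by (intro wsp_F z) (auto simp: Idx_def)
  have FF: "FF_elt i \<star> FF_elt j \<star> w = F i \<star> F j \<star> F (- i) \<star> F (- j) \<star> w" if "w \<in> hspace n" for w
    using commuteD[OF commute_FF[of "- i" j n], of "F (- j) \<star> w"] i j that
    by (simp add: act_mult hspace_act)
  have c: "commute n (F i) (F (- i) * F (- j))" "commute n (E i) (F (- i) * F (- j))"
    using i j by (auto intro!: commute_mult commute_FF commute_EF)
  have "F j \<star> E j \<star> FF_elt i \<star> FF_elt j \<star> B \<star> y = F j \<star> E j \<star> F i \<star> F j \<star> z'"
    by (simp only: FF hs z'_def)
  also have "\<dots> = F i \<star> F j \<star> F i \<star> E i \<star> z'"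
    using i j by (intro FE_slide[OF z']) (auto simp: \<nu>_def snd_hole_weight_pos snd_alpha)
  also have "F i \<star> E i \<star> z' = F (- i) \<star> F (- j) \<star> F i \<star> E i \<star> B \<star> y"
    using commuteD[OF c(2), of "B \<star> y"] commuteD[OF c(1), of "E i \<star> B \<star> y"] hs
    by (simp add: z'_def act_mult)
  also have "F i \<star> F j \<star> \<dots> = FF_elt i \<star> FF_elt j \<star> F i \<star> E i \<star> B \<star> y"
    by (simp only: FF hs)
  also have "F i \<star> E i \<star> B \<star> y = B \<star> F i \<star> E i \<star> y"
    by (simp only: commuteD[OF B(1)] commuteD[OF B(2)] hs)
  finally have *: "F j \<star> E j \<star> FF_elt i \<star> FF_elt j \<star> B \<star> y = FF_elt i \<star> FF_elt j \<star> B \<star> F i \<star> E i \<star> y" .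
  have "F j \<star> E j \<star> A \<star> w = A \<star> F j \<star> E j \<star> w" if "w \<in> hspace n" for w
    using commuteD[OF A(1), of "E j \<star> w"] commuteD[OF A(2), of w] that by (simp add: hspace_act)
  from this[of "FF_elt i \<star> FF_elt j \<star> B \<star> y"] show ?thesis
    by (simp only: push act_mult[of "A * FF_elt i * FF_elt j" B]
        act_mult[of "A * FF_elt i" "FF_elt j"] act_mult[of A "FF_elt i"] hs *)
qed

section \<open>Crossings and partial traces\<close>

lemma T_elt_Nil [simp]: "T_elt [] = 1"
  by (simp add: T_elt_def)

lemma T_elt_append: "T_elt (x @ y) = T_elt x * T_elt y"
  by (simp add: T_elt_def)

lemma T_elt_Cons: "T_elt (x # y) = sigma_elt x * T_elt y"
  by (simp add: T_elt_def)

definition twist :: "bool \<Rightarrow> ground" where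
  "twist e = (if e then inverse qvar else qvar)"

text \<open>At equal entries \<open>E\<close> and \<open>F\<close> of the same index commute, as [0]
  = 0. So both signs of a crossing take the same form and differ only in the scalar.\<close>

lemma sigma_act:
  assumes v: "v \<in> wsp n \<nu>" and i: "1 \<le> i" "i < n"
    and \<nu>: "snd (\<nu> (int i)) = 1" "snd (\<nu> (int i + 1)) = 1"
  shows "sigma_elt (i, e) \<star> v = scal (twist e) \<star> v - F (int i) \<star> E (int i) \<star> v"
proof (cases e)
  case False
  have "E (int i) \<star> F (int i) \<star> v = F (int i) \<star> E (int i) \<star> v"
    using act_EF[OF v Idx_pos, of "int i" 0] i \<nu> by simp
  with False show ?thesis by (simp add: act_simps twist_def)
qed (simp add: act_simps twist_def)

lemma wsp_sigma:
  assumes v: "v \<in> wsp n \<nu>" and i: "1 \<le> i" "i < n"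
  shows "sigma_elt (i, e) \<star> v \<in> wsp n \<nu>"
proof -
  have I: "int i \<in> Idx n n" using i by (intro Idx_pos) auto
  show ?thesis
    using wsp_F[OF wsp_E[OF v I] I] wsp_E[OF wsp_F[OF v I] I] v
    by (cases e) (simp_all add: act_simps wsp_add wsp_diff wsp_uminus wsp_scal)
qed

text \<open>Both bounds move: discarding the first strand raises \<open>lo\<close> to 2, and the
  induction on words raises it further, while \<open>hi\<close> is the number of strands.\<close>

definition letters_in :: "nat \<Rightarrow> nat \<Rightarrow> braid_word set" where
  "letters_in lo hi = {b. \<forall>(i, e)\<in>set b. lo \<le> i \<and> i < hi}"

lemma letters_in_simps [simp]:
  "[] \<in> letters_in lo hi"
  "(i, e) # x \<in> letters_in lo hi \<longleftrightarrow> lo \<le> i \<and> i < hi \<and> x \<in> letters_in lo hi"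
  "x @ y \<in> letters_in lo hi \<longleftrightarrow> x \<in> letters_in lo hi \<and> y \<in> letters_in lo hi"
  by (auto simp: letters_in_def)

lemma letters_in_mono: "x \<in> letters_in lo hi \<Longrightarrow> lo' \<le> lo \<Longrightarrow> hi \<le> hi' \<Longrightarrow> x \<in> letters_in lo' hi'"
  by (fastforce simp: letters_in_def)

lemma braid_words_letters_in: "braid_words n = letters_in 1 n"
  by (simp add: braid_words_def letters_in_def)

lemma wsp_T_elt: "b \<in> letters_in 1 m \<Longrightarrow> m \<le> n \<Longrightarrow> v \<in> wsp n \<nu> \<Longrightarrow> T_elt b \<star> v \<in> wsp n \<nu>"
  by (induction b) (auto simp: T_elt_Cons act_mult wsp_sigma)

definition shift_word :: "braid_word \<Rightarrow> braid_word" where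
  "shift_word = map (\<lambda>(i, e). (i - 1, e))"

lemma shift_word_simps [simp]:
  "shift_word [] = []" "shift_word (x # y) = (fst x - 1, snd x) # shift_word y"
  "shift_word (y @ z) = shift_word y @ shift_word z"
  by (simp_all add: shift_word_def case_prod_unfold)

lemma shift_word_letters: "b \<in> letters_in 2 (Suc m) \<Longrightarrow> shift_word b \<in> letters_in 1 m"
  by (induction b) auto

lemma sigma_push:
  assumes y: "y \<in> wsp n (hole_weight n (int m) (int m + 1))" and i: "2 \<le> i" "i \<le> m" "m < n"
  shows "sigma_elt (i, e) \<star> push m \<star> y = push m \<star> sigma_elt (i - 1, e) \<star> y"
proof -
  have FE: "F (int i) \<star> E (int i) \<star> push m \<star> y = push m \<star> F (int (i - 1)) \<star> E (int (i - 1)) \<star> y"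
    using i by (intro FE_push[OF y]) auto
  have "sigma_elt (i, e) \<star> push m \<star> y
      = scal (twist e) \<star> push m \<star> y - F (int i) \<star> E (int i) \<star> push m \<star> y"
    using i by (intro sigma_act[OF wsp_push[OF y]]) (auto simp: snd_hole_weight_pos)
  also have "\<dots> = push m \<star> (scal (twist e) \<star> y - F (int (i - 1)) \<star> E (int (i - 1)) \<star> y)"
    by (simp only: FE act_diff_right act_scal[of "push m"])
  also have "\<dots> = push m \<star> sigma_elt (i - 1, e) \<star> y"
    using i by (subst sigma_act[OF y]) (auto simp: snd_hole_weight_pos of_nat_diff)
  finally show ?thesis .
qed

lemma T_push:
  assumes y: "y \<in> wsp n (hole_weight n (int m) (int m + 1))" and m: "m < n"
    and b: "b \<in> letters_in 2 (Suc m)"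
  shows "T_elt b \<star> push m \<star> y = push m \<star> T_elt (shift_word b) \<star> y"
  using b
proof (induction b)
  case (Cons x b)
  obtain i e where x: "x = (i, e)" by force
  have "T_elt (shift_word b) \<star> y \<in> wsp n (hole_weight n (int m) (int m + 1))"
    using Cons.prems x m by (intro wsp_T_elt[of _ m] y shift_word_letters) auto
  from sigma_push[OF this, of i e] Cons x m show ?case
    by (simp add: T_elt_Cons act_mult)
qed simp

lemma commute_sigma_0:
  assumes "2 \<le> i"
  shows "commute n (E 0) (sigma_elt (i, e))" "commute n (F 0) (sigma_elt (i, e))"
  using assms by (cases e; auto intro!: commute_diff commute_mult
      commute_scal commute_EE commute_FF commute_EF commute_FE)+

lemma commute_T_0:
  assumes "b \<in> letters_in 2 m"
  shows "commute n (E 0) (T_elt b)" "commute n (F 0) (T_elt b)"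
  using assms by (induction b) (auto simp: T_elt_Cons intro!: commute_mult commute_1 commute_sigma_0)

lemma P_elt_act: "P_elt m b \<star> v = caps m \<star> T_elt b \<star> cups m \<star> v"
  by (simp add: P_elt_def caps_def cups_def act_mult)

lemma P_elt_Suc: "P_elt (Suc m) b \<star> hv n = outer_caps m \<star> E 0 \<star> T_elt b \<star> F 0 \<star> outer_cups m \<star> hv n"
  by (simp add: P_elt_act caps_Suc cups_Suc act_mult)

lemma hspace_outer_cups: "outer_cups m \<star> hv n \<in> hspace n"
  by (simp add: hspace_act hv_hspace)

lemma wsp_outer_cups:
  assumes "m < n"
  shows "outer_cups m \<star> hv n \<in> wsp n (hole_weight n (int m) 1)"
  using assms wsp_push[OF wsp_cups, of m n] by (simp add: outer_cups_eq[OF hv_hspace])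

text \<open>A braid that avoids the first strand passes through \<open>push m\<close> with its
  indices lowered by one, and then \<open>pull m\<close> cancels \<open>push m\<close>.\<close>

lemma outer_P:
  assumes m: "m < n" and b: "b \<in> letters_in 2 (Suc m)"
  shows "outer_caps m \<star> T_elt b \<star> outer_cups m \<star> hv n = P_elt m (shift_word b) \<star> hv n"
proof -
  have y: "cups m \<star> hv n \<in> wsp n (hole_weight n (int m) (int m + 1))"
    using m by (intro wsp_cups) auto
  have z: "T_elt (shift_word b) \<star> cups m \<star> hv n \<in> wsp n (hole_weight n (int m) (int m + 1))"
    using m by (intro wsp_T_elt[OF shift_word_letters[OF b] _ y]) auto
  have "outer_caps m \<star> T_elt b \<star> outer_cups m \<star> hv n
      = caps m \<star> pull m \<star> T_elt b \<star> push m \<star> cups m \<star> hv n"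
    by (simp add: outer_cups_eq[OF hv_hspace] outer_caps_eq[where n = n] hspace_act hv_hspace)
  also have "\<dots> = P_elt m (shift_word b) \<star> hv n"
    by (simp add: T_push[OF y m b] pull_push[OF z m] P_elt_act)
  finally show ?thesis .
qed

text \<open>No letter touches the first strand, so \<open>F 0\<close> commutes up to
  \<open>E 0\<close> and the strand closes to a free loop.\<close>

lemma P_elt_loop:
  assumes m: "m < n" and b: "b \<in> letters_in 2 (Suc m)"
  shows "P_elt (Suc m) b \<star> hv n = scal (qint (1, 0)) \<star> P_elt m (shift_word b) \<star> hv n"
proof -
  let ?y = "outer_cups m \<star> hv n"
  have y: "T_elt b \<star> ?y \<in> wsp n (hole_weight n (int m) 1)"
    using m letters_in_mono[OF b, of 1 "Suc m"] by (intro wsp_T_elt[of _ "Suc m"] wsp_outer_cups) auto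
  have "E 0 \<star> T_elt b \<star> F 0 \<star> ?y = E 0 \<star> F 0 \<star> T_elt b \<star> ?y"
    by (simp add: commuteD[OF commute_T_0(2)[OF b, of n]] hspace_outer_cups)
  also have "\<dots> = scal (qint (1, 0)) \<star> T_elt b \<star> ?y"
    using m by (intro loop_empty[OF y]) (auto simp: snd_hole_weight)
  finally show ?thesis
    by (simp add: P_elt_Suc act_scal outer_P[OF m b])
qed

text \<open>\<open>E 0\<close> moves down through \<open>a\<close> and \<open>F 0\<close> moves up
  through \<open>b\<close> until they enclose the single crossing, whose partial trace is given by
  \<open>qint_loop\<close>.\<close>

lemma P_elt_markov:
  assumes m: "1 \<le> m" "m < n" and a: "a \<in> letters_in 2 (Suc m)" and b: "b \<in> letters_in 2 (Suc m)"
  shows "P_elt (Suc m) (a @ (1, e) # b) \<star> hv n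
    = scal (if e then inverse lvar else lvar) \<star> P_elt m (shift_word (a @ b)) \<star> hv n"
proof -
  let ?y = "T_elt b \<star> outer_cups m \<star> hv n"
  have y: "?y \<in> wsp n (hole_weight n (int m) 1)"
    using m letters_in_mono[OF b, of 1 "Suc m"] by (intro wsp_T_elt[of _ "Suc m"] wsp_outer_cups) auto
  have I: "0 \<in> Idx n n" using m by (auto simp: Idx_def)
  have "sigma_elt (1, e) \<star> F 0 \<star> ?y = scal (twist e) \<star> F 0 \<star> ?y - F (int 1) \<star> E (int 1) \<star> F 0 \<star> ?y"
    using m by (intro sigma_act[OF wsp_F[OF y I]]) (auto simp: snd_alpha snd_hole_weight)
  then have "E 0 \<star> sigma_elt (1, e) \<star> F 0 \<star> ?y
      = scal (twist e) \<star> E 0 \<star> F 0 \<star> ?y - E 0 \<star> F 1 \<star> E 1 \<star> F 0 \<star> ?y"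
    by (simp add: act_diff_right act_scal_EF)
  also have "\<dots> = scal (twist e * qint (1, 0) - qint (1, - 1)) \<star> ?y"
    using m loop_empty[OF y] loop_FE[OF y] by (simp add: snd_hole_weight scal_diff scal_mult act_simps)
  also have "twist e * qint (1, 0) - qint (1, - 1) = (if e then inverse lvar else lvar)"
    by (simp add: twist_def qint_loop)
  finally have *: "E 0 \<star> sigma_elt (1, e) \<star> F 0 \<star> ?y = scal (if e then inverse lvar else lvar) \<star> ?y" .
  have "E 0 \<star> T_elt a \<star> sigma_elt (1, e) \<star> T_elt b \<star> F 0 \<star> outer_cups m \<star> hv n
      = T_elt a \<star> E 0 \<star> sigma_elt (1, e) \<star> F 0 \<star> ?y"
    by (simp add: commuteD[OF commute_T_0(1)[OF a, of n]] commuteD[OF commute_T_0(2)[OF b, of n]]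
        hspace_act hv_hspace)
  also have "\<dots> = scal (if e then inverse lvar else lvar) \<star> T_elt (a @ b) \<star> outer_cups m \<star> hv n"
    by (simp only: * act_scal T_elt_append act_mult)
  finally show ?thesis
    using a b m by (simp add: P_elt_Suc T_elt_append[of a "_ # b"] T_elt_Cons act_mult act_scal
        outer_P del: shift_word_simps)
qed

section \<open>The Hecke algebra at the bottom of the braid\<close>

definition strands_space :: "nat \<Rightarrow> nat \<Rightarrow> hmod set" where
  "strands_space n m = wsp n (hole_weight n (int m) (int m + 1))"

lemma strands_space_T:
  "b \<in> letters_in 1 m \<Longrightarrow> m \<le> n \<Longrightarrow> v \<in> strands_space n m \<Longrightarrow> T_elt b \<star> v \<in> strands_space n m"
  unfolding strands_space_def by (rule wsp_T_elt)

lemma strands_sigma_act: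
  assumes "v \<in> strands_space n m" "1 \<le> i" "i < m" "m \<le> n"
  shows "sigma_elt (i, e) \<star> v = scal (twist e) \<star> v - F (int i) \<star> E (int i) \<star> v"
    "F (int i) \<star> E (int i) \<star> v \<in> strands_space n m"
    "F (int i) \<star> E (int i) \<star> F (int i) \<star> E (int i) \<star> v = scal qtwo \<star> F (int i) \<star> E (int i) \<star> v"
proof -
  have I: "int i \<in> Idx n n" using assms by (intro Idx_pos) auto
  note v = assms(1)[unfolded strands_space_def]
  show "sigma_elt (i, e) \<star> v = scal (twist e) \<star> v - F (int i) \<star> E (int i) \<star> v"
    using assms by (intro sigma_act[OF v]) (auto simp: snd_hole_weight_pos)
  show "F (int i) \<star> E (int i) \<star> v \<in> strands_space n m"
    using wsp_F[OF wsp_E[OF v I] I] by (simp add: strands_space_def)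
  show "F (int i) \<star> E (int i) \<star> F (int i) \<star> E (int i) \<star> v = scal qtwo \<star> F (int i) \<star> E (int i) \<star> v"
    using assms by (intro FE_square[OF v]) (auto simp: snd_hole_weight_pos)
qed

lemma strands_closed:
  "v \<in> strands_space n m \<Longrightarrow> scal c \<star> v \<in> strands_space n m"
  "v \<in> strands_space n m \<Longrightarrow> w \<in> strands_space n m \<Longrightarrow> v - w \<in> strands_space n m"
  by (simp_all add: strands_space_def wsp_scal wsp_diff)

lemma sigma_skein:
  assumes "v \<in> strands_space n m" "1 \<le> i" "i < m" "m \<le> n"
  shows "sigma_elt (i, True) \<star> v - sigma_elt (i, False) \<star> v = scal (inverse qvar - qvar) \<star> v"
  unfolding strands_sigma_act(1)[OF assms] by (simp add: twist_def scal_diff act_simps)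

text \<open>With X = F E and X^2 = [2] X, the product (t - X)(1/t - X) is 1, because t + 1/t = [2]
  for t = q or 1/q.\<close>

lemma sigma_inverse:
  assumes v: "v \<in> strands_space n m" and i: "1 \<le> i" "i < m" "m \<le> n"
  shows "sigma_elt (i, e) \<star> sigma_elt (i, \<not> e) \<star> v = v"
proof -
  let ?X = "F (int i) \<star> E (int i) \<star> v"
  note X = strands_sigma_act(2)[OF v i]
  have "sigma_elt (i, e) \<star> sigma_elt (i, \<not> e) \<star> v
      = scal (twist e) \<star> (scal (twist (\<not> e)) \<star> v - ?X)
        - (scal (twist (\<not> e)) \<star> ?X - scal qtwo \<star> ?X)"
    using strands_sigma_act(1)[OF strands_closed(2)[OF strands_closed(1)[OF v] X] i]
    by (simp add: strands_sigma_act[OF v i] act_diff_right act_scal_EF)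
  also have "\<dots> = v"
    using qvar_nonzero
    by (cases e) (simp_all add: twist_def act_diff_right scal_act_scal scal_add act_add_left)
  finally show ?thesis .
qed

lemma sigma_far:
  assumes "1 < \<bar>int i - int j\<bar>" "v \<in> hspace n"
  shows "sigma_elt (i, e) \<star> sigma_elt (j, f) \<star> v = sigma_elt (j, f) \<star> sigma_elt (i, e) \<star> v"
proof (rule commuteD[OF _ assms(2)])
  have 1: "commute n (E k) (sigma_elt (i, e))" "commute n (F k) (sigma_elt (i, e))"
    if "1 < \<bar>k - int i\<bar>" for k i e
    using that by (cases e; auto intro!: commute_diff commute_mult
      commute_scal commute_EE commute_FF commute_EF commute_FE)+
  have "commute n (sigma_elt (i, e)) (E (int j))" "commute n (sigma_elt (i, e)) (F (int j))"
    using 1[of "int j" i e, THEN commute_sym] assms(1) by (simp_all add: abs_minus_commute)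
  then show "commute n (sigma_elt (i, e)) (sigma_elt (j, f))"
    by (cases f) (auto intro!: commute_diff commute_mult commute_scal)
qed

text \<open>For crossings t - X and t - Y the two sides differ by (t [2] - t^2)(X - Y) - (XYX -
  YXY). The first coefficient is 1, so this is \<open>FE_braid\<close>.\<close>

lemma sigma_braid:
  assumes v: "v \<in> strands_space n m" and i: "1 \<le> i" "Suc i < m" "m \<le> n"
  shows "sigma_elt (i, e) \<star> sigma_elt (Suc i, e) \<star> sigma_elt (i, e) \<star> v
    = sigma_elt (Suc i, e) \<star> sigma_elt (i, e) \<star> sigma_elt (Suc i, e) \<star> v"
proof -
  define X where "X w = F (int i) \<star> E (int i) \<star> w" for w
  define Y where "Y w = F (int (Suc i)) \<star> E (int (Suc i)) \<star> w" for w
  define t where "t = twist e"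
  have Xs: "X w \<in> strands_space n m" "sigma_elt (i, e) \<star> w = scal t \<star> w - X w" "X (X w) = scal qtwo \<star> X w"
    "Y w \<in> strands_space n m" "sigma_elt (Suc i, e) \<star> w = scal t \<star> w - Y w" "Y (Y w) = scal qtwo \<star> Y w"
    if "w \<in> strands_space n m" for w
    using strands_sigma_act(1)[OF that, of _ e] strands_sigma_act(2,3)[OF that, of i]
      strands_sigma_act(2,3)[OF that, of "Suc i"] i
    by (simp_all add: X_def Y_def t_def)
  have lin: "X (w - w') = X w - X w'" "X (scal c \<star> w) = scal c \<star> X w"
    "Y (w - w') = Y w - Y w'" "Y (scal c \<star> w) = scal c \<star> Y w" for w w' c
    by (simp_all add: X_def Y_def act_diff_right act_scal_EF)
  have "X (Y (X v)) - X v = Y (X (Y v)) - Y v"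
    unfolding X_def Y_def using i v[unfolded strands_space_def]
    by (intro FE_braid) (auto simp: snd_hole_weight_pos)
  then have br: "X (Y (X v)) = Y (X (Y v)) - Y v + X v"
    by (simp add: algebra_simps)
  \<comment> \<open>Both values of t are roots of t^2 - [2] t + 1; this is the one fact about the
    scalar that the expansion uses.\<close>
  have t: "t * t + 1 = t * qtwo"
    using qvar_nonzero by (simp add: t_def twist_def field_simps)
  have t': "scal t \<star> scal qtwo \<star> w = scal t \<star> scal t \<star> w + w" for w
  proof -
    have "scal t \<star> scal qtwo \<star> w = scal (t * t + 1) \<star> w"
      by (simp only: scal_act_scal t)
    then show ?thesis
      by (simp only: scal_add act_add_left scal_1 act_1 scal_act_scal)
  qed
  note s = Xs v strands_closed
  show ?thesis
    by (simp only: s lin act_diff_right br t')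
      (simp add: algebra_simps)
qed

section \<open>Functions on braid words that satisfy the Hecke relations\<close>

abbreviation occs :: "nat \<Rightarrow> braid_word \<Rightarrow> nat" where
  "occs i b \<equiv> count_list (map fst b) i"

text \<open>The last clause is the skein relation in the form suited to a proof of vanishing: when
  the smoothed word has value 0, the sign of the crossing may be changed. No scalars occur, so the
  values may lie in any type with a zero.\<close>

definition hecke_compatible :: "nat \<Rightarrow> nat \<Rightarrow> (braid_word \<Rightarrow> 'a::zero) \<Rightarrow> bool" where
  "hecke_compatible lo hi g \<longleftrightarrow> (\<forall>x\<in>letters_in lo hi. \<forall>y\<in>letters_in lo hi.
     (\<forall>i j e f. lo \<le> i \<and> Suc i < j \<and> j < hi \<longrightarrow> g (x @ (i, e) # (j, f) # y) = g (x @ (j, f) # (i, e) # y)) \<and>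
     (\<forall>i e. lo \<le> i \<and> i < hi \<longrightarrow> g (x @ (i, e) # (i, \<not> e) # y) = g (x @ y)) \<and>
     (\<forall>i e. lo \<le> i \<and> Suc i < hi \<longrightarrow>
        g (x @ (i, e) # (Suc i, e) # (i, e) # y) = g (x @ (Suc i, e) # (i, e) # (Suc i, e) # y)) \<and>
     (\<forall>i e f. lo \<le> i \<and> i < hi \<and> g (x @ y) = 0 \<longrightarrow> g (x @ (i, e) # y) = g (x @ (i, f) # y)))"

lemma hecke_compatible_dest:
  assumes "hecke_compatible lo hi g" "x \<in> letters_in lo hi" "y \<in> letters_in lo hi" "lo \<le> i"
  shows "Suc i < j \<Longrightarrow> j < hi \<Longrightarrow> g (x @ (i, e) # (j, f) # y) = g (x @ (j, f) # (i, e) # y)"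
    and "i < hi \<Longrightarrow> g (x @ (i, e) # (i, \<not> e) # y) = g (x @ y)"
    and "Suc i < hi \<Longrightarrow>
        g (x @ (i, e) # (Suc i, e) # (i, e) # y) = g (x @ (Suc i, e) # (i, e) # (Suc i, e) # y)"
    and "i < hi \<Longrightarrow> g (x @ y) = 0 \<Longrightarrow> g (x @ (i, e) # y) = g (x @ (i, f) # y)"
  using assms unfolding hecke_compatible_def by blast+

lemma letters_in_down: "x \<in> letters_in (Suc lo) hi \<Longrightarrow> x \<in> letters_in lo hi"
  by (rule letters_in_mono) auto

text \<open>Freezing a context yields a function of the word inside it, to which the induction on
  the lowest index can be applied.\<close>

lemma hecke_compatible_slice:
  assumes g: "hecke_compatible lo hi g" and x: "x \<in> letters_in lo hi" and y: "y \<in> letters_in lo hi"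
  shows "hecke_compatible (Suc lo) hi (\<lambda>u. g (x @ u @ y))"
  unfolding hecke_compatible_def
proof (intro ballI conjI allI impI, goal_cases)
  case (1 u v i j e f)
  then show ?case
    using hecke_compatible_dest(1)[OF g, of "x @ u" "v @ y" i j e f] x y letters_in_down[of u lo hi] letters_in_down[of v lo hi] by simp
next
  case (2 u v i e)
  then show ?case
    using hecke_compatible_dest(2)[OF g, of "x @ u" "v @ y" i e] x y letters_in_down[of u lo hi] letters_in_down[of v lo hi] by simp
next
  case (3 u v i e)
  then show ?case
    using hecke_compatible_dest(3)[OF g, of "x @ u" "v @ y" i e] x y letters_in_down[of u lo hi] letters_in_down[of v lo hi] by simp
next
  case (4 u v i e f)
  then show ?case
    using hecke_compatible_dest(4)[OF g, of "x @ u" "v @ y" i e f] x y letters_in_down[of u lo hi] letters_in_down[of v lo hi] by simp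
qed

lemma hecke_compatible_move:
  assumes g: "hecke_compatible lo hi g" and x: "x \<in> letters_in lo hi" and y: "y \<in> letters_in lo hi"
    and lo: "lo < hi" and v: "v \<in> letters_in (Suc (Suc lo)) hi"
  shows "g (x @ (lo, e) # v @ y) = g (x @ v @ (lo, e) # y)"
  using v x
proof (induction v arbitrary: x)
  case (Cons a v)
  obtain j f where a: "a = (j, f)" by force
  have "v @ y \<in> letters_in lo hi"
    using Cons.prems y a letters_in_down[of v lo hi] letters_in_down[of v "Suc lo" hi] by simp
  then have "g (x @ (lo, e) # (j, f) # v @ y) = g (x @ (j, f) # (lo, e) # v @ y)"
    using Cons.prems a by (intro hecke_compatible_dest(1)[OF g]) auto
  with Cons.IH[of "x @ [a]"] Cons.prems a show ?case by simp
qed simp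

lemma split_occurrence:
  assumes "occs i b > 0"
  obtains x e y where "b = x @ (i, e) # y" "occs i x = 0"
proof -
  have "i \<in> fst ` set b"
    using assms count_list_0_iff[of "map fst b" i] by (metis less_irrefl set_map)
  then have "\<exists>l\<in>set b. fst l = i" by auto
  from split_list_first_prop[OF this] show thesis
    using that by (force simp: count_list_0_iff)
qed

lemma letters_in_Suc: "b \<in> letters_in lo hi \<Longrightarrow> occs lo b = 0 \<Longrightarrow> b \<in> letters_in (Suc lo) hi"
  by (force simp: letters_in_def count_list_0_iff)

text \<open>Between two consecutive letters of the lowest index, induction leaves at most one letter of
  the next index. The two lowest letters can then be made adjacent and cancelled, or the braid
  relation applies; either way the number of lowest letters drops.\<close>

lemma hecke_compatible_zero:
  assumes "hecke_compatible lo hi g"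
    and "\<And>b. b \<in> letters_in lo hi \<Longrightarrow> occs lo b \<le> 1 \<Longrightarrow> g b = 0"
    and "b \<in> letters_in lo hi"
  shows "g b = 0"
  using assms
\<comment> \<open>The outer induction raises the lowest index and generalises \<open>g\<close>,
  since it will be used for \<open>g\<close> in a frozen context. The inner one lowers the number of
  letters of lowest index.\<close>
proof (induction "hi - lo" arbitrary: lo g b rule: less_induct)
  case outer: less
  note g = outer.prems(1)
  from outer.prems(3) show ?case
  proof (induction "occs lo b" arbitrary: b rule: less_induct)
    case less
    show ?case
    proof (cases "occs lo b \<le> 1")
      case True
      then show ?thesis using outer.prems(2) less.prems by blast
    next
      case False
      then have "occs lo b > 0" by simp
      then obtain x e r where b1: "b = x @ (lo, e) # r" and x0: "occs lo x = 0"
        by (rule split_occurrence)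
      have "occs lo r > 0" using False b1 x0 by simp
      then obtain u f y where r: "r = u @ (lo, f) # y" and u0: "occs lo u = 0"
        by (rule split_occurrence)
      have b: "b = (x @ [(lo, e)]) @ u @ (lo, f) # y" using b1 r by simp
      have L: "x \<in> letters_in lo hi" "y \<in> letters_in lo hi" "u \<in> letters_in (Suc lo) hi" "lo < hi"
        using less.prems u0 by (auto simp: b letters_in_Suc)
      have N: "occs lo b = occs lo y + 2" using x0 u0 by (simp add: b)
      have IH: "g b' = 0" if "b' \<in> letters_in lo hi" "occs lo b' < occs lo y + 2" for b'
        using less.hyps[of b'] that N by simp
      have up: "v \<in> letters_in lo hi" "occs lo v = 0" if "v \<in> letters_in (Suc lo) hi" for v
        using that letters_in_down[OF that] by (simp_all, force simp: letters_in_def count_list_0_iff)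
      have up2: "v \<in> letters_in (Suc lo) hi" if "v \<in> letters_in (Suc (Suc lo)) hi" for v
        using that by (rule letters_in_down)
      \<comment> \<open>Between the first two letters of index \<open>lo\<close> only higher letters
        occur. By the outer hypothesis it is enough that \<open>h\<close> vanishes on words with at
        most one letter \<open>Suc lo\<close>.\<close>
      define h where "h u = g ((x @ [(lo, e)]) @ u @ (lo, f) # y)" for u
      have "h u = 0"
      proof (rule outer.hyps[of "Suc lo" h])
        show "hi - Suc lo < hi - lo" using L by simp
        show "hecke_compatible (Suc lo) hi h"
          unfolding h_def using L by (intro hecke_compatible_slice[OF g]) auto
        show "u \<in> letters_in (Suc lo) hi" by (rule L)
      next
        fix v assume v: "v \<in> letters_in (Suc lo) hi" "occs (Suc lo) v \<le> 1"
        show "h v = 0"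
        proof (cases "occs (Suc lo) v = 0")
          case True
          then have v2: "v \<in> letters_in (Suc (Suc lo)) hi" using v by (simp add: letters_in_Suc)
          have "h v = g (x @ (lo, e) # v @ ((lo, f) # y))" by (simp add: h_def)
          also have "\<dots> = g ((x @ v @ [(lo, e)]) @ (lo, f) # y)"
            using L v2 by (subst hecke_compatible_move[OF g]) auto
          \<comment> \<open>Smoothing the second crossing leaves one lowest letter fewer, so by
            \<open>IH\<close> its sign can be chosen to cancel the first.\<close>
          also have "\<dots> = g ((x @ v @ [(lo, e)]) @ (lo, \<not> e) # y)"
            using L v up[OF v(1)] x0 by (intro hecke_compatible_dest(4)[OF g] IH) auto
          also have "\<dots> = g ((x @ v) @ y)"
            using hecke_compatible_dest(2)[OF g, of "x @ v" y lo e] L v up[OF v(1)] by simp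
          also have "\<dots> = 0"
            using L v up[OF v(1)] x0 by (intro IH) auto
          finally show ?thesis .
        next
          case False
          then have "occs (Suc lo) v > 0" by simp
          then obtain v1 d v2 where vs: "v = v1 @ (Suc lo, d) # v2" and v1: "occs (Suc lo) v1 = 0"
            by (rule split_occurrence)
          then have "occs (Suc lo) v2 = 0" using v by simp
          then have L1: "v1 \<in> letters_in (Suc (Suc lo)) hi" "v2 \<in> letters_in (Suc (Suc lo)) hi" "Suc lo < hi"
            using v1 v vs by (auto simp: letters_in_Suc)
          note L2 = up[OF up2[OF L1(1)]] up[OF up2[OF L1(2)]]
          have "h v = g (x @ (lo, e) # v1 @ ((Suc lo, d) # v2 @ (lo, f) # y))"
            by (simp add: h_def vs)
          also have "\<dots> = g (x @ v1 @ (lo, e) # (Suc lo, d) # v2 @ (lo, f) # y)"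
            using L L1 L2 by (subst hecke_compatible_move[OF g]) auto
          also have "\<dots> = g ((x @ v1 @ [(lo, e), (Suc lo, d)]) @ (lo, f) # v2 @ y)"
            using L L1 L2 by (subst hecke_compatible_move[OF g]) auto
          \<comment> \<open>Both lowest letters are given the sign \<open>d\<close> of the letter
            between them, as the braid relation is stated for equal signs. Applying it leaves one
            lowest letter in place of two.\<close>
          also have "\<dots> = g ((x @ v1 @ [(lo, e), (Suc lo, d)]) @ (lo, d) # v2 @ y)"
            using L L1 L2 x0 by (intro hecke_compatible_dest(4)[OF g] IH) auto
          also have "\<dots> = g ((x @ v1) @ (lo, e) # (Suc lo, d) # (lo, d) # v2 @ y)"
            by simp
          also have "\<dots> = g ((x @ v1) @ (lo, d) # (Suc lo, d) # (lo, d) # v2 @ y)"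
            using L L1 L2 x0 by (intro hecke_compatible_dest(4)[OF g] IH) auto
          also have "\<dots> = g ((x @ v1) @ (Suc lo, d) # (lo, d) # (Suc lo, d) # v2 @ y)"
            using L L1 L2 by (intro hecke_compatible_dest(3)[OF g]) auto
          also have "\<dots> = 0"
            using L L1 L2 x0 by (intro IH) auto
          finally show ?thesis .
        qed
      qed
      then show ?thesis by (simp add: b h_def)
    qed
  qed
qed

section \<open>Closures of braids\<close>

text \<open>The level between cups and caps: downward closing arcs on the left, the braid on the
  right.\<close>

definition strands :: "nat \<Rightarrow> dir list" where
  "strands m = replicate m Down @ replicate m Up"

definition cup_layers :: "nat \<Rightarrow> diagram" where
  "cup_layers m = map (\<lambda>j. (j, Cup Down)) [0..<m]"

definition cap_layers :: "nat \<Rightarrow> diagram" where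
  "cap_layers m = map (\<lambda>j. (j, Cap)) (rev [0..<m])"

definition braid_layers :: "nat \<Rightarrow> braid_word \<Rightarrow> diagram" where
  "braid_layers m b = map (\<lambda>(i, e). (m + i - 1, Cross e)) (rev b)"

lemma closure_diagram_layers: "closure_diagram m b = cup_layers m @ braid_layers m b @ cap_layers m"
  by (simp add: closure_diagram_def cup_layers_def cap_layers_def braid_layers_def)

lemma braid_layers_simps [simp]:
  "braid_layers m [] = []"
  "braid_layers m (x @ y) = braid_layers m y @ braid_layers m x"
  "braid_layers m ((i, e) # x) = braid_layers m x @ [(m + i - 1, Cross e)]"
  by (simp_all add: braid_layers_def)

lemma run_append: "run (A @ B) s = Option.bind (run A s) (run B)"
  by (induction A arbitrary: s) (auto split: bind_split)

lemma strands_Suc: "strands (Suc m) = replicate m Down @ Down # Up # replicate m Up"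
  by (simp add: strands_def replicate_app_Cons_same)

lemma step_cup: "step (m, Cup Down) (strands m) = Some (strands (Suc m))"
  by (simp add: strands_Suc) (simp add: strands_def)

lemma step_cap: "step (m, Cap) (strands (Suc m)) = Some (strands m)"
  by (simp add: strands_Suc nth_append) (simp add: strands_def)

lemma strands_nth: "m \<le> p \<Longrightarrow> p < 2 * m \<Longrightarrow> strands m ! p = Up"
  by (simp add: strands_def nth_append)

lemma length_strands [simp]: "length (strands m) = 2 * m"
  by (simp add: strands_def)

lemma step_cross: "m \<le> p \<Longrightarrow> p + 1 < 2 * m \<Longrightarrow> step (p, Cross e) (strands m) = Some (strands m)"
  using strands_nth[of m p] strands_nth[of m "p + 1"]
  by (simp) (metis list_update_id)

lemma run_cup_layers: "run (cup_layers m) [] = Some (strands m)"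
proof (induction m)
  case (Suc m)
  then show ?case by (simp add: cup_layers_def run_append step_cup del: step.simps)
qed (simp add: cup_layers_def strands_def)

lemma run_cap_layers: "run (cap_layers m) (strands m) = Some []"
proof (induction m)
  case (Suc m)
  then show ?case by (simp add: cap_layers_def step_cap del: step.simps)
qed (simp add: cap_layers_def strands_def)

text \<open>Layers that cross only upward strands; these leave \<open>strands m\<close>
  unchanged.\<close>

definition crossings_at :: "nat \<Rightarrow> diagram set" where
  "crossings_at m = {X. \<forall>(p, c)\<in>set X. (\<exists>e. c = Cross e) \<and> m \<le> p \<and> p + 1 < 2 * m}"

lemma run_crossings: "X \<in> crossings_at m \<Longrightarrow> run X (strands m) = Some (strands m)"
  by (induction X) (auto simp: crossings_at_def step_cross simp del: step.simps)

lemma braid_layers_crossings: "b \<in> letters_in 1 m \<Longrightarrow> braid_layers m b \<in> crossings_at m"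
  by (fastforce simp: crossings_at_def braid_layers_def letters_in_def)

lemma run_to_braid: "b \<in> letters_in 1 m \<Longrightarrow> run (cup_layers m @ braid_layers m b) [] = Some (strands m)"
  by (simp add: run_append run_cup_layers run_crossings braid_layers_crossings)

lemma link_diagram_closure: "b \<in> letters_in 1 m \<Longrightarrow> link_diagram (closure_diagram m b)"
  by (simp add: link_diagram_def closure_diagram_layers run_append run_cup_layers run_crossings
      braid_layers_crossings run_cap_layers)

text \<open>\<open>writhe\<close> with a free initial level, which makes it additive under
  concatenation.\<close>

definition writhe_from :: "dir list \<Rightarrow> diagram \<Rightarrow> int" where
  "writhe_from s D = (\<Sum>m<length D. case D ! m of
       (i, Cross c) \<Rightarrow> if positive (the (run (take m D) s)) i c then 1 else - 1
     | _ \<Rightarrow> 0)"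

lemma writhe_from_Nil [simp]: "writhe_from s [] = 0"
  by (simp add: writhe_from_def)

lemma writhe_from_Cons:
  assumes "step x s = Some t"
  shows "writhe_from s (x # D) =
    (case x of (i, Cross c) \<Rightarrow> if positive s i c then 1 else - 1 | _ \<Rightarrow> 0) + writhe_from t D"
  unfolding writhe_from_def length_Cons sum.lessThan_Suc_shift using assms by simp

lemma writhe_from_append:
  "run A s = Some t \<Longrightarrow> writhe_from s (A @ B) = writhe_from s A + writhe_from t B"
proof (induction A arbitrary: s)
  case (Cons x A)
  then obtain s' where "step x s = Some s'" "run A s' = Some t"
    by (auto split: bind_splits)
  then show ?case using Cons.IH by (simp add: writhe_from_Cons)
qed simp

lemma writhe_from_no_crossings:
  assumes "\<And>i c. (i, Cross c) \<notin> set D"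
  shows "writhe_from s D = 0"
  unfolding writhe_from_def
proof (rule sum.neutral, rule ballI)
  fix k assume "k \<in> {..<length D}"
  then have "D ! k \<in> set D" by simp
  with assms show "(case D ! k of (i, Cross c) \<Rightarrow> if positive (the (run (take k D) s)) i c then 1 else - 1
     | _ \<Rightarrow> 0) = (0 :: int)"
    by (force split: prod.split piece.split)
qed

definition word_writhe :: "braid_word \<Rightarrow> int" where
  "word_writhe b = (\<Sum>(i, e)\<leftarrow>b. if e then 1 else - 1)"

lemma word_writhe_simps [simp]:
  "word_writhe [] = 0" "word_writhe ((i, e) # b) = (if e then 1 else - 1) + word_writhe b"
  "word_writhe (x @ y) = word_writhe x + word_writhe y"
  by (simp_all add: word_writhe_def)

lemma word_writhe_shift [simp]: "word_writhe (shift_word b) = word_writhe b"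
  by (induction b) auto

lemma writhe_from_braid: "b \<in> letters_in 1 m \<Longrightarrow> writhe_from (strands m) (braid_layers m b) = word_writhe b"
proof (induction b)
  case (Cons x b)
  obtain i e where x: "x = (i, e)" by force
  then have *: "m \<le> m + i - 1" "m + i - 1 + 1 < 2 * m" using Cons.prems by auto
  have "writhe_from (strands m) [(m + i - 1, Cross e)] = (if e then 1 else - 1)"
    using * by (simp add: writhe_from_Cons[OF step_cross] positive_def strands_nth del: step.simps)
  then show ?case
    using Cons x by (simp add: writhe_from_append[OF run_crossings[OF braid_layers_crossings]])
qed simp

lemma writhe_closure:
  assumes "b \<in> letters_in 1 m"
  shows "writhe (closure_diagram m b) = word_writhe b"
proof -
  have "writhe (closure_diagram m b) = writhe_from [] (closure_diagram m b)"
    by (simp add: writhe_def writhe_from_def)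
  also have "\<dots> = word_writhe b"
  proof -
    have "writhe_from [] (cup_layers m) = 0" "writhe_from (strands m) (cap_layers m) = 0"
      by (rule writhe_from_no_crossings; auto simp: cup_layers_def cap_layers_def)+
    with assms show ?thesis
      by (simp add: closure_diagram_layers writhe_from_append[OF run_cup_layers] writhe_from_braid
          writhe_from_append[OF run_crossings[OF braid_layers_crossings]])
  qed
  finally show ?thesis .
qed

section \<open>Isotopies and the skein relation for closed braids\<close>

lemma invariant_move:
  assumes "link_invariant H" "planar_move x y \<or> reidemeister_move x y"
    "link_diagram (A @ x @ B)" "link_diagram (A @ y @ B)"
  shows "H (A @ x @ B) = H (A @ y @ B)"
proof -
  have "elementary_isotopy (A @ x @ B) (A @ y @ B)"
    unfolding elementary_isotopy_def using assms by blast
  then have "isotopic (A @ x @ B) (A @ y @ B)"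
    unfolding isotopic_def by (rule r_into_equivclp)
  then show ?thesis using assms(1) by (simp add: link_invariant_def)
qed

lemma closure_move:
  assumes H: "link_invariant H" and m: "planar_move (braid_layers m u) (braid_layers m v) \<or>
      reidemeister_move (braid_layers m u) (braid_layers m v)"
    and L: "x @ u @ y \<in> letters_in 1 m" "v \<in> letters_in 1 m"
  shows "H (closure_diagram m (x @ u @ y)) = H (closure_diagram m (x @ v @ y))"
proof -
  have "closure_diagram m (x @ w @ y)
      = (cup_layers m @ braid_layers m y) @ braid_layers m w @ (braid_layers m x @ cap_layers m)" for w
    by (simp add: closure_diagram_layers)
  moreover have "link_diagram (closure_diagram m (x @ u @ y))" "link_diagram (closure_diagram m (x @ v @ y))"
    using L by (auto intro!: link_diagram_closure)
  ultimately show ?thesis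
    using invariant_move[OF H m, of "cup_layers m @ braid_layers m y" "braid_layers m x @ cap_layers m"] by simp
qed

lemma closure_inverse:
  assumes H: "link_invariant H" and L: "x \<in> letters_in 1 m" "y \<in> letters_in 1 m" "1 \<le> i" "i < m"
  shows "H (closure_diagram m (x @ (i, e) # (i, \<not> e) # y)) = H (closure_diagram m (x @ y))"
  \<comment> \<open>\<open>R2\<close> starts with the sign \<open>\<not> e\<close>, because diagrams
    list the bottom layer first and words the top letter.\<close>
  using closure_move[OF H, of m "[(i, e), (i, \<not> e)]" "[]" x y] L
    reidemeister_move.R2[of "m + i - 1" "\<not> e"] by simp

lemma closure_braid:
  assumes H: "link_invariant H" and L: "x \<in> letters_in 1 m" "y \<in> letters_in 1 m" "1 \<le> i" "Suc i < m"
  shows "H (closure_diagram m (x @ (i, e) # (Suc i, e) # (i, e) # y))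
    = H (closure_diagram m (x @ (Suc i, e) # (i, e) # (Suc i, e) # y))"
proof -
  have "m + Suc i - 1 = m + i - 1 + 1" using L by simp
  then show ?thesis
    using closure_move[OF H, of m "[(i, e), (Suc i, e), (i, e)]" "[(Suc i, e), (i, e), (Suc i, e)]" x y] L
      reidemeister_move.R3[of e e e "m + i - 1"] by simp
qed

lemma closure_far:
  assumes H: "link_invariant H" and L: "x \<in> letters_in 1 m" "y \<in> letters_in 1 m" "1 \<le> i" "Suc i < j" "j < m"
  shows "H (closure_diagram m (x @ (i, e) # (j, f) # y)) = H (closure_diagram m (x @ (j, f) # (i, e) # y))"
proof -
  have "m + j - 1 = m + i - 1 + 2 + (j - i - 2)" using L by simp
  then show ?thesis
    using closure_move[OF H, of m "[(j, f), (i, e)]" "[(i, e), (j, f)]" x y] L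
      planar_move.exchange[of "m + i - 1" "Cross e" "j - i - 2" "Cross f"] by simp
qed

lemma closure_skein:
  assumes H: "is_homfly_pt H" and L: "x \<in> letters_in 1 m" "y \<in> letters_in 1 m" "1 \<le> i" "i < m"
  shows "inverse lvar * H (closure_diagram m (x @ (i, True) # y))
    - lvar * H (closure_diagram m (x @ (i, False) # y))
    = (inverse qvar - qvar) * H (closure_diagram m (x @ y))"
proof -
  let ?p = "m + i - 1"
  have nth: "strands m ! ?p = Up" "strands m ! (?p + 1) = Up"
    using L by (auto intro!: strands_nth)
  let ?A = "cup_layers m @ braid_layers m y" and ?B = "braid_layers m x @ cap_layers m"
  have "skein_triple (?A @ [(?p, Cross True)] @ ?B) (?A @ [(?p, Cross (\<not> True))] @ ?B)
      (?A @ smoothing (strands m) ?p @ ?B)"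
    unfolding skein_triple_def
  proof (intro exI conjI)
    show "link_diagram (?A @ [(?p, Cross True)] @ ?B)"
      using link_diagram_closure[of "x @ (i, True) # y" m] L by (simp add: closure_diagram_layers)
    show "run ?A [] = Some (strands m)" by (rule run_to_braid[OF L(2)])
    show "positive (strands m) ?p True" using nth by (simp add: positive_def)
  qed (use L in auto)
  moreover have "smoothing (strands m) ?p = []" using nth by (simp add: smoothing_def)
  ultimately show ?thesis
    using H by (simp add: is_homfly_pt_def closure_diagram_layers)
qed

text \<open>A cup or cap at position \<open>m\<close> shifts the strands to its right by two
  places.\<close>

definition raise :: "diagram \<Rightarrow> diagram" where
  "raise = map (\<lambda>(p, c). (Suc (Suc p), c))"

lemma raise_simps [simp]:
  "raise [] = []" "raise ((p, c) # X) = (Suc (Suc p), c) # raise X" "raise (X @ Y) = raise X @ raise Y"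
  by (simp_all add: raise_def)

lemma raise_crossings: "X \<in> crossings_at m \<Longrightarrow> raise X \<in> crossings_at (Suc m)"
  by (fastforce simp: crossings_at_def raise_def)

text \<open>The innermost cup rises past crossings lying to its right, one height exchange at a
  time. Both intermediate diagrams are closed, as \<open>elementary_isotopy\<close> demands.\<close>

lemma cup_slide:
  assumes H: "link_invariant H" and X: "X \<in> crossings_at m"
    and A: "run A [] = Some (strands m)" and B: "run B (strands (Suc m)) = Some []"
  shows "H (A @ (m, Cup Down) # raise X @ B) = H (A @ X @ (m, Cup Down) # B)"
  using X A
proof (induction X arbitrary: A)
  case (Cons x X)
  obtain p e where x: "x = (p, Cross e)" "m \<le> p" "p + 1 < 2 * m" and X: "X \<in> crossings_at m"
    using Cons.prems by (auto simp: crossings_at_def)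
  note st = step_cup step_cross[OF x(2,3)] step_cross[of "Suc m" "Suc (Suc p)"]
  have "planar_move [(m, Cup Down), (Suc (Suc p), Cross e)] [(p, Cross e), (m, Cup Down)]"
    using planar_move.exchange[of m "Cup Down" "p - m" "Cross e"] x by simp
  then have "H (A @ [(m, Cup Down), (Suc (Suc p), Cross e)] @ (raise X @ B))
      = H (A @ [(p, Cross e), (m, Cup Down)] @ (raise X @ B))"
    using x Cons.prems B
    by (intro invariant_move[OF H]; simp add: link_diagram_def run_append st
        run_crossings[OF raise_crossings[OF X]] del: step.simps)
  also have "\<dots> = H ((A @ [x]) @ X @ (m, Cup Down) # B)"
    using Cons.IH[of "A @ [x]"] X Cons.prems x by (simp add: run_append st del: step.simps)
  finally show ?case by (simp add: x)
qed simp

lemma cap_slide: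
  assumes H: "link_invariant H" and X: "X \<in> crossings_at m"
    and A: "run A [] = Some (strands (Suc m))" and B: "run B (strands m) = Some []"
  shows "H (A @ raise X @ (m, Cap) # B) = H (A @ (m, Cap) # X @ B)"
  using X A
proof (induction X arbitrary: A)
  case (Cons x X)
  obtain p e where x: "x = (p, Cross e)" "m \<le> p" "p + 1 < 2 * m" and X: "X \<in> crossings_at m"
    using Cons.prems by (auto simp: crossings_at_def)
  note st = step_cap step_cross[OF x(2,3)] step_cross[of "Suc m" "Suc (Suc p)"]
  have "planar_move [(m, Cap), (p, Cross e)] [(Suc (Suc p), Cross e), (m, Cap)]"
    using planar_move.exchange[of m "Cap" "p - m" "Cross e"] x by simp
  then have "H (A @ [(m, Cap), (p, Cross e)] @ (X @ B)) = H (A @ [(Suc (Suc p), Cross e), (m, Cap)] @ (X @ B))"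
    using x Cons.prems B
    by (intro invariant_move[OF H]; simp add: link_diagram_def run_append st
        run_crossings[OF X] del: step.simps)
  moreover have "H (A @ raise (x # X) @ (m, Cap) # B) = H (A @ [(Suc (Suc p), Cross e), (m, Cap)] @ (X @ B))"
    using Cons.IH[of "A @ [(Suc (Suc p), Cross e)]"] X Cons.prems x
    by (simp add: run_append st del: step.simps)
  ultimately show ?case by (simp add: x)
qed simp

lemma braid_layers_raise:
  "b \<in> letters_in 2 (Suc m) \<Longrightarrow> braid_layers (Suc m) b = raise (braid_layers m (shift_word b))"
  by (induction b) auto

text \<open>The innermost cup slides up past \<open>b\<close> and the innermost cap down past
  \<open>a\<close>. Together with the one crossing left between them they form a kink, which
  \<open>R1_left\<close> removes.\<close>

lemma closure_markov:
  assumes H: "link_invariant H" and a: "a \<in> letters_in 2 (Suc m)" and b: "b \<in> letters_in 2 (Suc m)"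
    and m: "1 \<le> m"
  shows "H (closure_diagram (Suc m) (a @ (1, e) # b)) = H (closure_diagram m (shift_word (a @ b)))"
proof -
  let ?a = "braid_layers m (shift_word a)" and ?b = "braid_layers m (shift_word b)"
  have X: "?a \<in> crossings_at m" "?b \<in> crossings_at m"
    using a b by (auto intro: braid_layers_crossings shift_word_letters)
  have st: "step (Suc m, Cross e) (strands (Suc m)) = Some (strands (Suc m))"
    using m by (intro step_cross) auto
  note runs = run_append run_cup_layers run_cap_layers step_cup step_cap st
    run_crossings[OF X(1)] run_crossings[OF X(2)]
    run_crossings[OF raise_crossings[OF X(1)]] run_crossings[OF raise_crossings[OF X(2)]]
  have "closure_diagram (Suc m) (a @ (1, e) # b)
      = cup_layers m @ (m, Cup Down) # raise ?b @ ((Suc m, Cross e) # raise ?a @ (m, Cap) # cap_layers m)"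
    using a b by (simp add: closure_diagram_layers braid_layers_raise)
      (simp add: cup_layers_def cap_layers_def)
  also have "H \<dots> = H (cup_layers m @ ?b @ (m, Cup Down) # ((Suc m, Cross e) # raise ?a @ (m, Cap) # cap_layers m))"
    using m by (intro cup_slide[OF H X(2)]) (simp_all add: runs del: step.simps)
  also have "\<dots> = H ((cup_layers m @ ?b @ [(m, Cup Down), (Suc m, Cross e)]) @ raise ?a @ (m, Cap) # cap_layers m)"
    by simp
  also have "\<dots> = H ((cup_layers m @ ?b @ [(m, Cup Down), (Suc m, Cross e)]) @ (m, Cap) # ?a @ cap_layers m)"
    using m by (intro cap_slide[OF H X(1)]) (simp_all add: runs del: step.simps)
  also have "\<dots> = H ((cup_layers m @ ?b) @ [(m, Cup Down), (m + 1, Cross e), (m, Cap)] @ (?a @ cap_layers m))"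
    by simp
  also have "\<dots> = H ((cup_layers m @ ?b) @ [] @ (?a @ cap_layers m))"
    using m reidemeister_move.R1_left[of m Down e]
    by (intro invariant_move[OF H]) (simp_all add: link_diagram_def runs del: step.simps)
  also have "(cup_layers m @ ?b) @ [] @ (?a @ cap_layers m) = closure_diagram m (shift_word (a @ b))"
    by (simp add: closure_diagram_layers)
  finally show ?thesis .
qed

section \<open>Endomorphisms of the highest weight object\<close>

text \<open>In \<open>Lambda n n\<close> the entries on the left are at most beta and those on the
  right at least 0, so every weight there is below \<open>hw n\<close> and the rule
  \<open>not_le\<close> has no instance.\<close>

lemma weyl_null_hw: "weyl_null n n (hw n) \<nu> x \<Longrightarrow> null n n (hw n) \<nu> x"
proof (induction rule: weyl_null.induct)
  case (not_le \<nu> x)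
  have "snd (\<nu> i) \<le> snd (hw n i)" if "i \<le> 0" for i
    using not_le(1) that by (cases "- int n < i") (auto simp: Lambda_def objects_def hw_def dest!: bspec[of _ _ i])
  moreover have "snd (\<nu> i) \<ge> snd (hw n i)" if "i > 0" for i
    using not_le(1) that by (cases "i \<le> int n") (auto simp: Lambda_def objects_def hw_def dest!: bspec[of _ _ i])
  ultimately have "\<nu> \<preceq>\<^sub>w hw n" by (simp add: weight_le_def)
  with not_le(2) show ?case by simp
qed (auto intro: null.intros)

lemma null_iff: "x \<in> hom_free n n (hw n) \<nu> \<Longrightarrow> null n n (hw n) \<nu> x \<longleftrightarrow> x \<star> hv n = 0"
  by (simp add: act_hv_eq_0_iff vanishes_hom_free)

lemma weyl_null_iff: "x \<in> hom_free n n (hw n) \<nu> \<Longrightarrow> weyl_null n n (hw n) \<nu> x \<longleftrightarrow> x \<star> hv n = 0"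
  using null_iff weyl_null_hw weyl_null.null by blast

lemma mor_iff:
  "x \<in> hom_free n n (hw n) \<nu> \<Longrightarrow>
    y \<in> mor n n (hw n) \<nu> x \<longleftrightarrow> y \<in> hom_free n n (hw n) \<nu> \<and> y \<star> hv n = x \<star> hv n"
  using null_iff[of "y - x" n \<nu>] by (auto simp: mor_def act_diff_left hom_free_diff)

lemma weyl_elt_iff:
  "x \<in> hom_free n n (hw n) \<nu> \<Longrightarrow>
    y \<in> weyl_elt n n (hw n) \<nu> x \<longleftrightarrow> y \<in> hom_free n n (hw n) \<nu> \<and> y \<star> hv n = x \<star> hv n"
  using weyl_null_iff[of "y - x" n \<nu>] by (auto simp: weyl_elt_def act_diff_left hom_free_diff)

lemma weyl_elt_eqI:
  "x \<in> hom_free n n (hw n) \<nu> \<Longrightarrow> y \<in> hom_free n n (hw n) \<nu> \<Longrightarrow> x \<star> hv n = y \<star> hv n \<Longrightarrow>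
    weyl_elt n n (hw n) \<nu> x = weyl_elt n n (hw n) \<nu> y"
  by (rule set_eqI) (simp add: weyl_elt_iff)

text \<open>The span of the words in the \<open>F i\<close> applied to \<open>hv n\<close>, graded
  by weight. The inductive form lets an \<open>E i\<close> be commuted inwards by rule induction
  until it reaches and kills \<open>hv n\<close>.\<close>

inductive lowered :: "nat \<Rightarrow> weight \<Rightarrow> hmod \<Rightarrow> bool" for n where
  hv: "lowered n (hw n) (hv n)"
| F: "lowered n \<nu> v \<Longrightarrow> i \<in> Idx n n \<Longrightarrow> lowered n (\<nu> - alpha i) (F i \<star> v)"
| zero: "lowered n \<nu> 0"
| add: "lowered n \<nu> v \<Longrightarrow> lowered n \<nu> w \<Longrightarrow> lowered n \<nu> (v + w)"
| scal: "lowered n \<nu> v \<Longrightarrow> lowered n \<nu> (scal c \<star> v)"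

lemma lowered_wsp: "lowered n \<nu> v \<Longrightarrow> v \<in> wsp n \<nu>"
proof (induction rule: lowered.induct)
  case (F \<nu> v i)
  from wsp_F[OF F.IH F(2)] show ?case unfolding fun_diff_def .
qed (simp_all add: wsp_hv wsp_0 wsp_add wsp_scal)

lemma E_hv:
  assumes i: "i \<in> Idx n n" shows "E i \<star> hv n = 0"
proof (cases "i < 0")
  case True
  with i show ?thesis
    by (intro wsp_above_beta[OF wsp_E[OF wsp_hv i], of i]) (auto simp: snd_alpha hw_def Idx_def)
next
  case False
  with i show ?thesis
    by (intro wsp_negative[OF wsp_E[OF wsp_hv i], of "i + 1"]) (auto simp: snd_alpha hw_def Idx_def)
qed

lemma lowered_E:
  assumes i: "i \<in> Idx n n"
  shows "lowered n \<nu> v \<Longrightarrow> lowered n (\<nu> + alpha i) (E i \<star> v)"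
proof (induction rule: lowered.induct)
  case hv
  then show ?case by (simp add: E_hv[OF i] lowered.zero)
next
  case (F \<nu> v j)
  have "lowered n (\<nu> + alpha i - alpha j) (F j \<star> E i \<star> v)"
    by (rule lowered.F[OF F.IH F(2)])
  moreover have "lowered n (\<nu> + alpha i - alpha j)
      (if i = j then scal (qint (\<nu> i - \<nu> (i + 1))) \<star> v else 0)"
    using F(1) by (auto intro: lowered.scal lowered.zero)
  ultimately have "lowered n (\<nu> + alpha i - alpha j) (E i \<star> F j \<star> v)"
    unfolding act_commutator[OF lowered_wsp[OF F(1)] i F(2)] by (rule lowered.add)
  then show ?case by (simp only: diff_add_eq)
qed (simp_all add: act_add_right act_scal_EF lowered.zero lowered.add lowered.scal)

text \<open>A linear functional with value 1 on each \<open>- alpha i\<close>, so on weights reached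
  from \<open>hw n\<close> by \<open>F\<close> alone it counts the letters.\<close>

definition height :: "nat \<Rightarrow> weight \<Rightarrow> int" where
  "height n \<nu> = (\<Sum>i\<in>{- int n..int n}. i * snd (\<nu> i))"

lemma height_diff_alpha:
  assumes i: "i \<in> Idx n n" shows "height n (\<nu> - alpha i) = height n \<nu> + 1"
proof -
  have "(\<Sum>j\<in>{- int n..int n}. j * snd (alpha i j)) = (\<Sum>j\<in>{i, i + 1}. j * snd (alpha i j))"
    using i by (intro sum.mono_neutral_right) (auto simp: Idx_def snd_alpha)
  then show ?thesis
    by (simp add: height_def algebra_simps sum_subtractf snd_alpha)
qed

text \<open>Every \<open>F\<close> raises the height by one, so that of \<open>hw n\<close> is least
  for nonzero vectors, and at this height no \<open>F\<close> can have contributed.\<close>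

lemma lowered_height:
  "lowered n \<nu> v \<Longrightarrow> (height n \<nu> < height n (hw n) \<longrightarrow> v = 0) \<and>
    (height n \<nu> = height n (hw n) \<longrightarrow> (\<exists>d. v = scal d \<star> hv n))"
proof (induction rule: lowered.induct)
  case hv
  show ?case by (auto intro: exI[of _ 1])
next
  case (F \<nu> v i)
  have "v = 0" if "height n (\<nu> - alpha i) \<le> height n (hw n)"
    using F.IH that by (simp add: height_diff_alpha[OF F(2)])
  then show ?case unfolding fun_diff_def by (auto intro: exI[of _ 0])
next
  case (zero \<nu>)
  show ?case by (auto intro: exI[of _ 0])
next
  case (add \<nu> v w)
  then show ?case by (auto simp flip: act_add_left scal_add)
next
  case (scal \<nu> v c)
  then show ?case by (auto simp: scal_act_scal)
qed

lemma lowered_word: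
  "gen_index ` set w \<subseteq> Idx n n \<Longrightarrow> lowered n (hw n + word_weight w) (Poly_Mapping.single w c \<star> hv n)"
proof (induction w)
  case Nil
  show ?case using lowered.scal[OF lowered.hv, of n c] by (simp add: scal_def)
next
  case (Cons g w)
  have g: "gen_index g \<in> Idx n n" and w: "gen_index ` set w \<subseteq> Idx n n"
    using Cons.prems by auto
  from Cons.IH[OF w] have IH: "lowered n (hw n + word_weight w) (Poly_Mapping.single w c \<star> hv n)"
    unfolding plus_fun_def .
  have "lowered n (hw n + word_weight w + gen_weight g) (Poly_Mapping.single [g] 1 \<star> Poly_Mapping.single w c \<star> hv n)"
    using lowered_E[OF _ IH] lowered.F[OF IH] g by (cases g) (auto simp: E_def F_def)
  then have "lowered n (hw n + word_weight (g # w)) (Poly_Mapping.single (g # w) c \<star> hv n)"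
    by (simp add: mult_single plus_list_def ac_simps flip: act_mult)
  then show ?case unfolding plus_fun_def .
qed

text \<open>Every \<open>E\<close> kills the highest weight vector, so only words in the \<open>F\<close>s survive, and the empty
  word is the only one of these of weight zero.\<close>

lemma hw_endomorphism:
  assumes x: "x \<in> hom_free n n (hw n) (hw n)"
  obtains d where "x \<star> hv n = scal d \<star> hv n"
proof -
  have "lowered n (hw n) ((\<Sum>k\<in>A. Poly_Mapping.single k (Poly_Mapping.lookup x k)) \<star> hv n)"
    if "finite A" "A \<subseteq> Poly_Mapping.keys x" for A
    using that
  proof (induction A)
    case (insert w A)
    have "lowered n (hw n) (Poly_Mapping.single w (Poly_Mapping.lookup x w) \<star> hv n)"
      using lowered_word[of w n] insert.prems x by (auto simp: hom_free_iff path_def)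
    with insert show ?case by (simp add: act_add_left lowered.add)
  qed (simp add: lowered.zero)
  from this[of "Poly_Mapping.keys x"] have "lowered n (hw n) (x \<star> hv n)"
    by (simp add: poly_mapping_sum_single)
  then show thesis using lowered_height that by blast
qed

text \<open>Quantifies over all starting objects, so the degree of a long product is a sum of
  degrees and no intermediate weight has to be computed.\<close>

definition homogeneous :: "nat \<Rightarrow> weight \<Rightarrow> free \<Rightarrow> bool" where
  "homogeneous n d x \<longleftrightarrow> (\<forall>\<nu>\<in>objects n n. \<nu> + d \<in> objects n n \<and> x \<in> hom_free n n \<nu> (\<nu> + d))"

lemma homogeneous_mult: "homogeneous n d x \<Longrightarrow> homogeneous n d' y \<Longrightarrow> homogeneous n (d' + d) (x * y)"
  unfolding homogeneous_def add.assoc[symmetric] by (blast intro: hom_free_mult)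

lemma homogeneous_diff: "homogeneous n d x \<Longrightarrow> homogeneous n d y \<Longrightarrow> homogeneous n d (x - y)"
  by (simp add: homogeneous_def hom_free_diff)

lemma homogeneous_scal: "homogeneous n 0 (scal c)"
  by (simp add: homogeneous_def hom_free_scal)

lemma homogeneous_1: "homogeneous n 0 1"
  by (simp add: homogeneous_def hom_free_1)

lemma homogeneous_E: "i \<in> Idx n n \<Longrightarrow> homogeneous n (alpha i) (E i)"
  by (simp add: homogeneous_def hom_free_E objects_add_alpha)

lemma homogeneous_F: "i \<in> Idx n n \<Longrightarrow> homogeneous n (- alpha i) (F i)"
  by (simp add: homogeneous_def hom_free_F objects_diff_alpha)

lemma homogeneous_prod_list:
  "(\<And>j. j \<in> set js \<Longrightarrow> homogeneous n (d j) (x j)) \<Longrightarrow>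
    homogeneous n (\<Sum>j\<leftarrow>js. d j) (\<Prod>j\<leftarrow>js. x j)"
proof (induction js)
  case (Cons j js)
  then have "homogeneous n ((\<Sum>j\<leftarrow>js. d j) + d j) (x j * (\<Prod>j\<leftarrow>js. x j))"
    by (intro homogeneous_mult) auto
  then show ?case by (simp only: list.map sum_list.Cons prod_list.Cons add.commute)
qed (simp add: homogeneous_1)

text \<open>The integer parts telescope to 1 at \<open>1 - j\<close> and -1 at \<open>j\<close>, the
  two positions joined by the arc \<open>j\<close>.\<close>

definition arc_weight :: "int \<Rightarrow> weight" where
  "arc_weight j = alpha 0 + (\<Sum>i\<leftarrow>[1..j - 1]. alpha (- i) + alpha i)"

lemma homogeneous_D_elt:
  assumes "1 \<le> j" "j \<le> int n" shows "homogeneous n (arc_weight j) (D_elt j)"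
proof -
  have "homogeneous n ((\<Sum>i\<leftarrow>[1..j - 1]. alpha (- i) + alpha i) + alpha 0) (D_elt j)"
    unfolding D_elt_def using assms
    by (intro homogeneous_mult homogeneous_prod_list homogeneous_E) (auto simp: Idx_def)
  then show ?thesis by (simp only: arc_weight_def add.commute)
qed

lemma homogeneous_C_elt:
  assumes "1 \<le> j" "j \<le> int n" shows "homogeneous n (- arc_weight j) (C_elt j)"
proof -
  have "homogeneous n (- alpha 0 + (\<Sum>i\<leftarrow>rev [1..j - 1]. - alpha (- i) + - alpha i)) (C_elt j)"
    unfolding C_elt_def using assms
    by (intro homogeneous_mult homogeneous_prod_list homogeneous_F) (auto simp: Idx_def)
  moreover have "(\<Sum>i\<leftarrow>rev [1..j - 1]. - alpha (- i) + - alpha i) = - (\<Sum>i\<leftarrow>[1..j - 1]. alpha (- i) + alpha i)"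
    by (simp only: rev_map[symmetric] sum_list_rev uminus_sum_list_map minus_add_distrib o_def)
  ultimately show ?thesis by (simp only: arc_weight_def minus_add_distrib)
qed

lemma homogeneous_T_elt: "b \<in> letters_in 1 n \<Longrightarrow> homogeneous n 0 (T_elt b)"
proof (induction b)
  case (Cons x b)
  obtain i e where x: "x = (i, e)" by force
  with Cons.prems have I: "int i \<in> Idx n n" by (auto intro: Idx_pos)
  have "homogeneous n 0 (F (int i) * E (int i))" "homogeneous n 0 (E (int i) * F (int i))"
    using homogeneous_mult[OF homogeneous_F[OF I] homogeneous_E[OF I]]
      homogeneous_mult[OF homogeneous_E[OF I] homogeneous_F[OF I]] by simp_all
  then have "homogeneous n 0 (sigma_elt x)"
    unfolding x by (cases e) (auto intro: homogeneous_diff homogeneous_scal)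
  from homogeneous_mult[OF this Cons.IH] Cons.prems x show ?case by (simp add: T_elt_Cons)
qed (simp add: homogeneous_1)

lemma homogeneous_P_elt:
  assumes "b \<in> letters_in 1 n" shows "homogeneous n 0 (P_elt n b)"
proof -
  have "homogeneous n ((\<Sum>j\<leftarrow>[1..int n]. - arc_weight j) + (0 + (\<Sum>j\<leftarrow>rev [1..int n]. arc_weight j))) (P_elt n b)"
    unfolding P_elt_def
    by (intro homogeneous_mult homogeneous_prod_list homogeneous_T_elt assms homogeneous_C_elt homogeneous_D_elt) auto
  moreover have "(\<Sum>j\<leftarrow>[1..int n]. - arc_weight j) + (0 + (\<Sum>j\<leftarrow>rev [1..int n]. arc_weight j)) = 0"
    by (simp only: rev_map[symmetric] sum_list_rev add_0 uminus_sum_list_map[unfolded o_def, symmetric] left_minus)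
  ultimately show ?thesis by simp
qed

section \<open>Comparison with the HOMFLY-PT polynomial\<close>

text \<open>This rescaling removes lambda from the left side of the skein relation, which then
  matches \<open>sigma_skein\<close>; in exchange a kink costs a factor 1/lambda or lambda, as in
  \<open>P_elt_markov\<close>.\<close>

definition framed_homfly :: "(diagram \<Rightarrow> ground) \<Rightarrow> nat \<Rightarrow> braid_word \<Rightarrow> ground" where
  "framed_homfly H m b = lvar powi (- word_writhe b) * H (closure_diagram m b)"

lemma lvar_powi:
  "lvar powi (- (w + 1)) = inverse lvar * lvar powi (- w)"
  "lvar powi (- (w - 1)) = lvar * lvar powi (- w)"
  using lvar_nonzero power_int_add[of lvar "- w" "- 1"] power_int_add[of lvar "- w" 1]
  by (simp_all add: power_int_minus algebra_simps)

lemma framed_homfly_skein: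
  assumes "is_homfly_pt H" "x \<in> letters_in 1 m" "y \<in> letters_in 1 m" "1 \<le> i" "i < m"
  shows "framed_homfly H m (x @ (i, True) # y) - framed_homfly H m (x @ (i, False) # y)
    = (inverse qvar - qvar) * framed_homfly H m (x @ y)"
proof -
  let ?w = "word_writhe x + word_writhe y"
  have "word_writhe (x @ (i, True) # y) = ?w + 1" "word_writhe (x @ (i, False) # y) = ?w - 1"
    "word_writhe (x @ y) = ?w" by simp_all
  then have "framed_homfly H m (x @ (i, True) # y) - framed_homfly H m (x @ (i, False) # y)
    = lvar powi (- ?w) * (inverse lvar * H (closure_diagram m (x @ (i, True) # y))
        - lvar * H (closure_diagram m (x @ (i, False) # y)))"
    by (simp only: framed_homfly_def lvar_powi) (simp add: algebra_simps)
  also have "\<dots> = (inverse qvar - qvar) * framed_homfly H m (x @ y)"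
    unfolding closure_skein[OF assms] by (simp add: framed_homfly_def)
  finally show ?thesis .
qed

lemma framed_homfly_markov:
  assumes "is_homfly_pt H" "a \<in> letters_in 2 (Suc m)" "b \<in> letters_in 2 (Suc m)" "1 \<le> m"
  shows "framed_homfly H (Suc m) (a @ (1, e) # b)
    = (if e then inverse lvar else lvar) * framed_homfly H m (shift_word (a @ b))"
proof -
  let ?w = "word_writhe a + word_writhe b"
  have "word_writhe (a @ (1, e) # b) = (if e then ?w + 1 else ?w - 1)" by simp
  then have "lvar powi (- word_writhe (a @ (1, e) # b)) = (if e then inverse lvar else lvar) * lvar powi (- ?w)"
    by (cases e) (simp_all only: lvar_powi if_True if_False)
  moreover have "word_writhe (shift_word (a @ b)) = ?w"
    by (simp only: word_writhe_shift word_writhe_simps)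
  ultimately show ?thesis
    using closure_markov[of H a m b e] assms unfolding framed_homfly_def is_homfly_pt_def
    by (simp only: mult.assoc)
qed

text \<open>The split circle is evaluated by a skein triple: \<open>b\<close> followed by a crossing
  on the first strand, of either sign, closes to a kink, and smoothing that crossing gives
  \<open>b\<close> with a free loop.\<close>

lemma framed_homfly_loop:
  assumes H: "is_homfly_pt H" and b: "b \<in> letters_in 2 (Suc m)" and m: "1 \<le> m"
  shows "framed_homfly H (Suc m) b = qint (1, 0) * framed_homfly H m (shift_word b)"
proof -
  let ?X = "framed_homfly H (Suc m) b" and ?Y = "framed_homfly H m (shift_word b)"
  have 1: "(inverse qvar - qvar) * ?X = inverse lvar * ?Y - lvar * ?Y"
    using framed_homfly_skein[OF H, of b "Suc m" "[]" 1] framed_homfly_markov[OF H b, of "[]"]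
      letters_in_mono[OF b, of 1 "Suc m"] m by (simp del: shift_word_simps)
  have 2: "qint (1, 0) * (qvar - inverse qvar) = lvar - inverse lvar"
    using q_minus_inverse_nonzero by (simp add: qint_def qpow_def power_int_minus)
  have "(qvar - inverse qvar) * ?X = - ((inverse qvar - qvar) * ?X)"
    by (simp only: minus_mult_left minus_diff_eq)
  also have "\<dots> = (lvar - inverse lvar) * ?Y"
    unfolding 1 by (simp add: left_diff_distrib)
  also have "\<dots> = (qvar - inverse qvar) * (qint (1, 0) * ?Y)"
    by (simp only: 2[symmetric] ac_simps)
  finally have "(qvar - inverse qvar) * ?X = (qvar - inverse qvar) * (qint (1, 0) * ?Y)" .
  then show ?thesis using q_minus_inverse_nonzero by simp
qed

text \<open>The number \<open>m\<close> of strands is separate from the parameter \<open>n\<close>,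
  so the induction on \<open>m\<close> takes place in one module.\<close>

definition defect :: "(diagram \<Rightarrow> ground) \<Rightarrow> nat \<Rightarrow> nat \<Rightarrow> braid_word \<Rightarrow> hmod" where
  "defect H n m b = P_elt m b \<star> hv n - scal (framed_homfly H m b) \<star> hv n"

lemma hecke_compatible_defect:
  assumes H: "is_homfly_pt H" and mn: "m \<le> n"
  shows "hecke_compatible 1 m (defect H n m)"
proof -
  have inv: "link_invariant H" using H by (simp add: is_homfly_pt_def)
  define z where "z y = T_elt y \<star> cups m \<star> hv n" for y
  have z: "z y \<in> strands_space n m" "z y \<in> hspace n" if "y \<in> letters_in 1 m" for y
    using strands_space_T[OF that mn] wsp_cups[OF mn]
    by (simp_all add: z_def strands_space_def hspace_act hv_hspace)
  have P: "P_elt m (x @ u @ y) \<star> hv n = caps m \<star> T_elt x \<star> T_elt u \<star> z y" for x u y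
    by (simp add: P_elt_act T_elt_append act_mult z_def)
  show ?thesis
    unfolding hecke_compatible_def
  proof (intro ballI conjI allI impI, goal_cases)
    case (1 x y i j e f)
    then have "T_elt [(i, e), (j, f)] \<star> z y = T_elt [(j, f), (i, e)] \<star> z y"
      using z[of y] by (auto simp: T_elt_def act_mult intro!: sigma_far simp del: sigma_elt.simps)
    then have "P_elt m (x @ [(i, e), (j, f)] @ y) \<star> hv n = P_elt m (x @ [(j, f), (i, e)] @ y) \<star> hv n"
      by (simp only: P)
    with 1 show ?case
      using closure_far[OF inv, of x m y i j e f] by (simp add: defect_def framed_homfly_def)
  next
    case (2 x y i e)
    then have "T_elt [(i, e), (i, \<not> e)] \<star> z y = T_elt [] \<star> z y"
      using z[of y] sigma_inverse[of "z y" n m i e] mn by (simp add: T_elt_def act_mult del: sigma_elt.simps)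
    then have "P_elt m (x @ [(i, e), (i, \<not> e)] @ y) \<star> hv n = P_elt m (x @ [] @ y) \<star> hv n"
      by (simp only: P)
    moreover have "word_writhe (x @ (i, e) # (i, \<not> e) # y) = word_writhe (x @ y)" by simp
    ultimately show ?case
      using closure_inverse[OF inv, of x m y i e] 2
      by (simp add: defect_def framed_homfly_def del: word_writhe_simps)
  next
    case (3 x y i e)
    then have "T_elt [(i, e), (Suc i, e), (i, e)] \<star> z y = T_elt [(Suc i, e), (i, e), (Suc i, e)] \<star> z y"
      using z[of y] sigma_braid[of "z y" n m i e] mn by (simp add: T_elt_def act_mult del: sigma_elt.simps)
    then have "P_elt m (x @ [(i, e), (Suc i, e), (i, e)] @ y) \<star> hv n
        = P_elt m (x @ [(Suc i, e), (i, e), (Suc i, e)] @ y) \<star> hv n"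
      by (simp only: P)
    with 3 show ?case
      using closure_braid[OF inv, of x m y i e] by (simp add: defect_def framed_homfly_def)
  next
    case (4 x y i e f)
    then have "T_elt [(i, True)] \<star> z y - T_elt [(i, False)] \<star> z y = scal (inverse qvar - qvar) \<star> z y"
      using sigma_skein[of "z y" n m i] z[of y] mn by (simp add: T_elt_def del: sigma_elt.simps)
    then have "caps m \<star> T_elt x \<star> (T_elt [(i, True)] \<star> z y - T_elt [(i, False)] \<star> z y)
        = scal (inverse qvar - qvar) \<star> caps m \<star> T_elt x \<star> T_elt [] \<star> z y"
      by (simp only: act_scal T_elt_Nil act_1)
    then have "P_elt m (x @ [(i, True)] @ y) \<star> hv n - P_elt m (x @ [(i, False)] @ y) \<star> hv n
        = scal (inverse qvar - qvar) \<star> P_elt m (x @ [] @ y) \<star> hv n"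
      by (simp only: P act_diff_right)
    moreover have "scal (framed_homfly H m (x @ (i, True) # y)) \<star> hv n - scal (framed_homfly H m (x @ (i, False) # y)) \<star> hv n
        = scal (inverse qvar - qvar) \<star> scal (framed_homfly H m (x @ y)) \<star> hv n"
      using framed_homfly_skein[OF H, of x m y i] 4
      by (simp add: scal_act_scal flip: act_diff_left scal_diff)
    ultimately have "defect H n m (x @ (i, True) # y) - defect H n m (x @ (i, False) # y)
        = scal (inverse qvar - qvar) \<star> defect H n m (x @ y)"
      by (simp add: defect_def act_diff_right algebra_simps)
    \<comment> \<open>The two defects differ by a multiple of the defect of the smoothed word, which
      is 0 by assumption.\<close>
    with 4 have "defect H n m (x @ (i, True) # y) = defect H n m (x @ (i, False) # y)"
      by simp
    then show ?case by (cases e; cases f) simp_all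
  qed
qed

text \<open>\<open>hecke_compatible_zero\<close> leaves words with at most one letter of index 1.
  Without one the first strand is a free loop, with one it is a kink; on both sides it comes off
  with the same factor, leaving \<open>m\<close> strands.\<close>

lemma P_elt_hv:
  assumes H: "is_homfly_pt H" and m: "1 \<le> m" "m \<le> n" and b: "b \<in> letters_in 1 m"
  shows "P_elt m b \<star> hv n = scal (framed_homfly H m b) \<star> hv n"
  using m b
proof (induction m arbitrary: b rule: nat_induct_at_least)
  case base
  then have "b = []" by (cases b) auto
  moreover have "H (closure_diagram 1 []) = qint (1, 0)"
    using H by (simp add: closure_diagram_def is_homfly_pt_def qint_def qpow_def power_int_minus)
  moreover have "P_elt 0 [] = 1" by (simp add: P_elt_def)
  ultimately show ?case
    using P_elt_loop[of 0 n "[]"] base by (simp add: framed_homfly_def)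
next
  case (Suc m)
  have "defect H n (Suc m) b = 0"
  proof (rule hecke_compatible_zero[OF hecke_compatible_defect[OF H Suc.prems(1)] _ Suc.prems(2)])
    fix u assume u: "u \<in> letters_in 1 (Suc m)" "occs 1 u \<le> 1"
    show "defect H n (Suc m) u = 0"
    proof (cases "occs 1 u = 0")
      case True
      then have "u \<in> letters_in 2 (Suc m)"
        using letters_in_Suc[OF u(1)] by (simp add: numeral_2_eq_2)
      then show ?thesis
        using Suc P_elt_loop[of m n u] framed_homfly_loop[OF H, of u m] shift_word_letters[of u m]
        by (simp add: defect_def scal_act_scal)
    next
      case False
      then have "occs 1 u > 0" by simp
      then obtain x e y where uxy: "u = x @ (1, e) # y" and x: "occs 1 x = 0"
        by (rule split_occurrence)
      then have "x \<in> letters_in 2 (Suc m)" "y \<in> letters_in 2 (Suc m)"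
        using u letters_in_Suc[of x 1 "Suc m"] letters_in_Suc[of y 1 "Suc m"]
        by (auto simp: numeral_2_eq_2)
      then show ?thesis
        using Suc P_elt_markov[of m n x y e] framed_homfly_markov[OF H, of x m y e]
          shift_word_letters[of "x @ y" m]
        by (simp add: defect_def scal_act_scal uxy del: shift_word_simps)
    qed
  qed
  then show ?case by (simp add: defect_def)
qed

text \<open>By \<open>hw_endomorphism\<close> every vector of weight \<open>hw n\<close> is a
  multiple of \<open>hv n\<close>, so the scalar found on \<open>hv n\<close> is valid on all of
  them. Independence of representatives makes the unions in \<open>act\<close> and
  \<open>weyl_scale\<close> single classes.\<close>

lemma act_weyl_elt:
  assumes x: "x \<in> hom_free n n (hw n) (hw n)" and c: "x \<star> hv n = scal c \<star> hv n"
    and v: "v \<in> hom_free n n (hw n) (hw n)"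
  shows "act n n (hw n) (hw n) (mor n n (hw n) (hw n) x) (weyl_elt n n (hw n) (hw n) v)
    = weyl_scale n n (hw n) (hw n) c (weyl_elt n n (hw n) (hw n) v)"
proof -
  obtain d where d: "v \<star> hv n = scal d \<star> hv n"
    using hw_endomorphism[OF v] .
  note cv = hom_free_mult[OF hom_free_scal[OF hw_in_objects] v, of c]
  have 1: "weyl_elt n n (hw n) (hw n) (x' * v') = weyl_elt n n (hw n) (hw n) (scal c * v)"
    if "x' \<in> mor n n (hw n) (hw n) x" "v' \<in> weyl_elt n n (hw n) (hw n) v" for x' v'
  proof (rule weyl_elt_eqI)
    show "x' * v' \<in> hom_free n n (hw n) (hw n)"
      using that hom_free_mult by (auto simp: mor_iff[OF x] weyl_elt_iff[OF v])
    have "x' \<star> v' \<star> hv n = scal d \<star> scal c \<star> hv n"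
      using that d c by (simp add: mor_iff[OF x] weyl_elt_iff[OF v] act_scal[of x'])
    then show "(x' * v') \<star> hv n = (scal c * v) \<star> hv n"
      by (simp add: act_mult d scal_act_scal mult.commute)
  qed (rule cv)
  have 2: "weyl_elt n n (hw n) (hw n) (scal c * v') = weyl_elt n n (hw n) (hw n) (scal c * v)"
    if "v' \<in> weyl_elt n n (hw n) (hw n) v" for v'
    using that cv hom_free_mult[OF hom_free_scal[OF hw_in_objects], of v']
    by (intro weyl_elt_eqI) (auto simp: weyl_elt_iff[OF v] act_mult)
  have "x \<in> mor n n (hw n) (hw n) x" "v \<in> weyl_elt n n (hw n) (hw n) v"
    using x v by (simp_all add: mor_iff weyl_elt_iff)
  then show ?thesis
    unfolding act_def weyl_scale_def using 1 2 by blast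
qed

theorem proposition2p5:
  fixes n :: nat and b :: braid_word and H :: "diagram \<Rightarrow> ground"
    and L :: diagram and \<mu> :: weight and p :: "free set"
  assumes "n \<ge> 1"
    and "b \<in> braid_words n"
    and "is_homfly_pt H"
  defines "L \<equiv> closure_diagram n b"
    and "\<mu> \<equiv> hw n"
    and "p \<equiv> mor n n (hw n) (hw n)
                (scal (lvar powi writhe (closure_diagram n b)) * P_elt n b)"
  shows "p \<in> Hom n n \<mu> \<mu> \<and>
    act n n \<mu> \<mu> p (highest n n \<mu>) = weyl_scale n n \<mu> \<mu> (H L) (highest n n \<mu>) \<and>
    (\<forall>v\<in>Weyl n n \<mu> \<mu>. act n n \<mu> \<mu> p v = weyl_scale n n \<mu> \<mu> (H L) v)"
proof -
  let ?x = "scal (lvar powi writhe (closure_diagram n b)) * P_elt n b"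
  have b: "b \<in> letters_in 1 n" using assms(2) by (simp add: braid_words_letters_in)
  have "homogeneous n 0 ?x"
    using homogeneous_mult[OF homogeneous_scal homogeneous_P_elt[OF b]] by simp
  then have x: "?x \<in> hom_free n n (hw n) (hw n)"
    using hw_in_objects by (auto simp: homogeneous_def)
  have "?x \<star> hv n = scal (lvar powi word_writhe b) \<star> scal (framed_homfly H n b) \<star> hv n"
    by (simp add: act_mult writhe_closure[OF b] P_elt_hv[OF assms(3,1) le_refl b])
  \<comment> \<open>The writhe factor of the theorem cancels the one in
    \<open>framed_homfly\<close>.\<close>
  also have "\<dots> = scal (H L) \<star> hv n"
    using lvar_nonzero
    by (simp add: scal_act_scal framed_homfly_def L_def power_int_minus flip: mult.assoc)
  finally have "?x \<star> hv n = scal (H L) \<star> hv n" .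
  note act = act_weyl_elt[OF x this, folded p_def \<mu>_def]
  have "p \<in> Hom n n \<mu> \<mu>" using x by (simp add: Hom_def p_def \<mu>_def)
  moreover have "act n n \<mu> \<mu> p (highest n n \<mu>) = weyl_scale n n \<mu> \<mu> (H L) (highest n n \<mu>)"
    unfolding highest_def using hom_free_1[OF hw_in_objects] by (intro act) (simp add: \<mu>_def)
  ultimately show ?thesis using act by (auto simp: Weyl_def)
qed

end
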